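(* Let $k\ge1$, let $\mathbf D_\infty\subset SU_2$ be the infinite binary dihedral group generated by $g,h$ (see context), let $\mathbf C_\infty$ be the subgroup generated by $g$, and let $Z_k(\mathbf D_\infty)=\mathrm{End}_{\mathbf D_\infty}(V^{\otimes k})$, $Z_k(\mathbf C_\infty)=\mathrm{End}_{\mathbf C_\infty}(V^{\otimes k})$, where $V=\mathbb C^2$. Then: (a) $Z_k(\mathbf D_\infty)=\{X\in Z_k(\mathbf C_\infty)\mid hX=Xh\}$. (b) A basis for $Z_k(\mathbf D_\infty)$ is $\mathcal B^k(\mathbf D_\infty)=\{\mathsf E_{\mathsf r,\mathsf s}+\mathsf E_{-\mathsf r,-\mathsf s}\mid\mathsf r,\mathsf s\in\{-1,1\}^k,\ \mathsf r\succ-\mathsf r,\ |\mathsf r|=|\mathsf s|\}$. (c) $\dim Z_k(\mathbf D_\infty)=\frac12\dim Z_k(\mathbf C_\infty)=\frac12\binom{2k}k=\binom{2k-1}k=\frac12\big(\text{coefficient of }z^k\text{ in }(1+z)^{2k}\big)$. (d) For $\ell=0,1,\dots,k$ such that $k-\ell$ is even, let $\tilde{\mathsf K}_\ell=\{\mathsf r\in\{-1,1\}^k\mid k-2|\mathsf r|=\ell\}=\{\mathsf r\in\{-1,1\}^k\mid|\mathsf r|=\frac12(k-\ell)\}$. (i) When $1\le\ell\le k$, $Z_k^{(\ell)}=Z_k(\mathbf D_\infty)^{(\ell)}=\mathrm{span}_{\mathbb C}\{v_{\mathsf t}\mid\mathsf t\in\tilde{\mathsf K}_\ell\}$ is an irreducible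 $Z_k(\mathbf D_\infty)$-module with $\dim Z_k^{(\ell)}=\binom kb$, where $b=\frac12(k-\ell)$. For all $\mathsf r,\mathsf s,\mathsf t\in\tilde{\mathsf K}_\ell$, $\mathsf e_{\mathsf r,\mathsf s}v_{\mathsf t}=\delta_{\mathsf s,\mathsf t}v_{\mathsf r}$, where $\mathsf e_{\mathsf r,\mathsf s}=\mathsf E_{\mathsf r,\mathsf s}+\mathsf E_{-\mathsf r,-\mathsf s}\in Z_k(\mathbf D_\infty)$. (ii) When $\ell=0$ (necessarily $k$ is even), $Z_k^{(0)}=\mathrm{span}_{\mathbb C}\{v_{\mathsf t}+i^{-k}v_{-\mathsf t}\mid\mathsf t\in\tilde{\mathsf K}_0\}$ and $Z_k^{(0')}=\mathrm{span}_{\mathbb C}\{v_{\mathsf t}-i^{-k}v_{-\mathsf t}\mid\mathsf t\in\tilde{\mathsf K}_0\}$ are irreducible $Z_k(\mathbf D_\infty)$-modules with dimensions $\dim Z_k^{(0)}=\dim Z_k^{(0')}=\frac12\binom kb$, where $b=\frac12k$, and $$\mathsf e^\pm_{\mathsf r,\mathsf s}(v_{\mathsf t}\pm i^{-k}v_{-\mathsf t})=\delta_{\mathsf s,\mathsf t}(v_{\mathsf r}\pm i^{-k}v_{-\mathsf r}),\qquad\mathsf e^\pm_{\mathsf r,\mathsf s}(v_{\mathsf t}\mp i^{-k}v_{-\mathsf t})=0$$ for $\mathsf e^\pm_{\mathsf r,\mathsf s}:=\frac12\big((\mathsf E_{\mathsf r,\mathsf s}+\mathsf E_{-\mathsf r,-\mathsf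 s})\pm i^{-k}(\mathsf E_{\mathsf r,-\mathsf s}+\mathsf E_{-\mathsf r,\mathsf s})\big)$ with $\mathsf r,\mathsf s\in\tilde{\mathsf K}_0$ (and $\mathsf t\in\tilde{\mathsf K}_0$, as in the spans above). (e) $Z_k(\mathbf D_\infty)\cong\mathsf Q_k$, where $\mathsf Q_k$ is the subalgebra of the planar rook algebra $\mathsf{PR}_k$ having basis (i) $\{\mathsf X_{\mathsf R,\mathsf S}\mid0\le|\mathsf R|=|\mathsf S|\le\frac12(k-1)\}$ when $k$ is odd; (ii) $\{\mathsf X_{\mathsf R,\mathsf S}\mid0\le|\mathsf R|=|\mathsf S|\le\frac12(k-2)\}\cup\{\mathsf X_{\mathsf R,\mathsf S},\ \mathsf X_{-\mathsf R,-\mathsf S}\mid|\mathsf R|=|\mathsf S|=\frac12k,\ \mathsf R\succ-\mathsf R,\ \mathsf S\succ-\mathsf S\}$ when $k$ is even.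
   Context: $\mathbf D_\infty$ is generated by $g=\mathrm{diag}(\zeta^{-1},\zeta)$, where $\zeta=e^{i\theta}$, $\theta\in\mathbb R$, is not a root of unity, and $h=\begin{pmatrix}0&i\\i&0\end{pmatrix}$, $i=\sqrt{-1}$. $V=\mathbb C^2$ has basis $v_{-1}=(1,0)^t$, $v_1=(0,1)^t$; the groups act diagonally on $V^{\otimes k}$. For $\mathsf r\in\{-1,1\}^k$: $v_{\mathsf r}=v_{r_1}\otimes\cdots\otimes v_{r_k}$, $-\mathsf r=(-r_1,\dots,-r_k)$, $|\mathsf r|$ is the number of $j$ with $r_j=-1$; $\mathsf E_{\mathsf r,\mathsf s}v_{\mathsf t}=\delta_{\mathsf s,\mathsf t}v_{\mathsf r}$. Order on $\{-1,1\}^k$: $\mathsf r\succeq\mathsf s$ if $|\mathsf r|\le|\mathsf s|$ and, in case $|\mathsf r|=|\mathsf s|$, $\mathsf r$ is greater than or equal to $\mathsf s$ in the lexicographic order coming from $1>-1$; $\succ$ is the strict version. The planar rook algebra $\mathsf{PR}_k$ is the complex monoid algebra of the monoid of order-preserving partial injections of $\{1,\dots,k\}$; it has a basis of matrix units $\{\mathsf X_{\mathsf R,\mathsf S}\mid\mathsf R,\mathsf S\subseteq\{1,\dots,k\},|\mathsf R|=|\mathsf S|\}$ with $\mathsf X_{\mathsf R,\mathsf S}\mathsf X_{\mathsf T,\mathsf U}=\delta_{\mathsf S,\mathsf T}\mathsf X_{\mathsf R,\mathsf U}$. A subset $\mathsf R\subseteq\{1,\dots,k\}$ is identified with the tuple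 $\mathsf r\in\{-1,1\}^k$ with $r_j=-1$ iff $j\in\mathsf R$; under this identification $-\mathsf R$ is the complement of $\mathsf R$ and $\succ$ is transported to subsets.
   Formalization: In (d)(ii) the first formula e^±_{r,s}(v_t ± i^{-k}v_{-t}) = δ_{s,t}(v_r ± i^{-k}v_{-r}) is stated only for t ≠ -s; for t = -s it is false, the left side being ±i^{-k}(v_r ± i^{-k}v_{-r}) ≠ 0. *)

theory Defs
  imports
    "HOL-Analysis.Analysis"
    "HOL-Algebra.Generated_Groups"
    "HOL-Computational_Algebra.Polynomial"
    "HOL-Library.Function_Algebras"
    "HOL-Library.Fun_Lexorder"
    "HOL-Library.Poly_Mapping"
begin

section \<open>Sign tuples\<close>

text \<open>
  The truth value \<^term>\<open>False\<close> stands for the sign -1 and \<^term>\<open>True\<close> for the sign 1, so that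
  the order and the negation of type \<^typ>\<open>bool\<close> are those of the signs.  The positions
  1, ..., k of a tensor power are the elements of a finite linearly ordered type \<open>'k\<close>
  (with k the cardinality of \<open>'k\<close>, hence k positive but otherwise arbitrary).  For
  \<open>r :: 'k tuple\<close> the tuple \<open>- r\<close> is the pointwise negation.
\<close>

type_synonym 'k tuple = "'k \<Rightarrow> bool"

definition wt :: "'k::finite tuple \<Rightarrow> nat" where
  "wt r = card {j. r j = False}"

definition tuple_ge :: "'k::{finite,linorder} tuple \<Rightarrow> 'k tuple \<Rightarrow> bool" (infix \<open>\<succeq>\<close> 50) where
  "r \<succeq> s \<longleftrightarrow> wt r \<le> wt s \<and> (wt r = wt s \<longrightarrow> r = s \<or> less_fun s r)"

definition tuple_gt :: "'k::{finite,linorder} tuple \<Rightarrow> 'k tuple \<Rightarrow> bool" (infix \<open>\<succ>\<close> 50) where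
  "r \<succ> s \<longleftrightarrow> r \<succeq> s \<and> r \<noteq> s"

definition tuple_of_set :: "'k set \<Rightarrow> 'k tuple" where
  "tuple_of_set R = (\<lambda>j. if j \<in> R then False else True)"

lemma tuple_of_set_uminus: "tuple_of_set (- R) = - tuple_of_set R"
  by (auto simp: tuple_of_set_def fun_eq_iff)

definition K_set :: "nat \<Rightarrow> 'k::finite tuple set" where
  "K_set l = {r. int CARD('k) - 2 * int (wt r) = int l}"


section \<open>The infinite binary dihedral group\<close>

text \<open>
  Coordinates of \<^typ>\<open>complex ^ bool\<close> are listed in the order \<^term>\<open>False\<close>, \<^term>\<open>True\<close>, that is,
  -1 before 1; this is the order in which the matrices below are to be read.
\<close>

definition SU2 :: "(complex ^ bool ^ bool) monoid" where
  "SU2 = \<lparr>carrier = {A. A ** (\<chi> i j. cnj (A $ j $ i)) = mat 1 \<and> det A = 1},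
          monoid.mult = (**), one = mat 1\<rparr>"

definition g_mat :: "complex \<Rightarrow> complex ^ bool ^ bool" where
  "g_mat z = (\<chi> i j. if i = j then (if i then z else inverse z) else 0)"

definition h_mat :: "complex ^ bool ^ bool" where
  "h_mat = (\<chi> i j. if i = j then 0 else \<i>)"

lemma det_bool:
  "det (A :: complex ^ bool ^ bool) = A$False$False * A$True$True - A$False$True * A$True$False"
proof -
  have f: "finite {True}" "False \<notin> {True}" by auto
  show ?thesis
    unfolding det_def UNIV_bool
    unfolding sum_over_permutations_insert[OF f]
    unfolding permutes_sing
    by (simp add: sign_swap_id sign_id)
qed

lemma group_SU2: "group SU2"
proof (rule groupI)
  fix A B C assume "A \<in> carrier SU2"
  then have A: "A ** (\<chi> i j. cnj (A $ j $ i)) = mat 1" "det A = 1" by (auto simp: SU2_def)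
  show "\<one>\<^bsub>SU2\<^esub> \<otimes>\<^bsub>SU2\<^esub> A = A" by (simp add: SU2_def)
  show "A \<otimes>\<^bsub>SU2\<^esub> B \<otimes>\<^bsub>SU2\<^esub> C = A \<otimes>\<^bsub>SU2\<^esub> (B \<otimes>\<^bsub>SU2\<^esub> C)"
    by (simp add: SU2_def matrix_mul_assoc)
  define A' where "A' = (\<chi> i j. cnj (A $ j $ i))"
  have 1: "A' ** A = mat 1" using A(1) by (simp add: A'_def matrix_left_right_inverse)
  have "det A' = 1"
    by (metis "1" A(2) det_I det_mul mult_1_right)
  moreover have "(\<chi> i j. cnj (A' $ j $ i)) = A" by (simp add: A'_def vec_eq_iff)
  ultimately have "A' \<in> carrier SU2" using 1 by (simp add: SU2_def)
  then show "\<exists>y\<in>carrier SU2. y \<otimes>\<^bsub>SU2\<^esub> A = \<one>\<^bsub>SU2\<^esub>"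
    using 1 by (auto simp: SU2_def)
  assume "B \<in> carrier SU2"
  then have B: "B ** (\<chi> i j. cnj (B $ j $ i)) = mat 1" "det B = 1" by (auto simp: SU2_def)
  have "(\<chi> i j. cnj ((A ** B) $ j $ i)) = (\<chi> i j. cnj (B $ j $ i)) ** A'"
    by (simp add: matrix_matrix_mult_def A'_def mult.commute)
  then have "(A ** B) ** (\<chi> i j. cnj ((A ** B) $ j $ i)) =  A ** (B ** (\<chi> i j. cnj (B $ j $ i))) ** A'"
    by (simp only: matrix_mul_assoc)
  then have "(A ** B) ** (\<chi> i j. cnj ((A ** B) $ j $ i)) = mat 1"
    using A B by (simp add: A'_def)
  then show "A \<otimes>\<^bsub>SU2\<^esub> B \<in> carrier SU2"
    using A B by (simp add: SU2_def det_mul)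
next
  show "\<one>\<^bsub>SU2\<^esub> \<in> carrier SU2"
    by (auto simp: SU2_def mat_def matrix_matrix_mult_def vec_eq_iff UNIV_bool det_bool)
qed

lemma generators_in_SU2:
  assumes "cmod z = 1" shows "g_mat z \<in> carrier SU2" "h_mat \<in> carrier SU2"
proof -
  have z: "z * cnj z = 1" "z \<noteq> 0" using assms by (auto simp: complex_norm_square[symmetric])
  then have "inverse z * inverse (cnj z) = 1"
    by (metis inverse_1 inverse_mult_distrib)
  with z show "g_mat z \<in> carrier SU2" "h_mat \<in> carrier SU2"
    by (auto simp: SU2_def g_mat_def h_mat_def det_bool matrix_matrix_mult_def mat_def vec_eq_iff
        UNIV_bool)
qed

definition D_inf :: "complex \<Rightarrow> (complex ^ bool ^ bool) set" where
  "D_inf z = generate SU2 {g_mat z, h_mat}"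

definition C_inf :: "complex \<Rightarrow> (complex ^ bool ^ bool) set" where
  "C_inf z = generate SU2 {g_mat z}"


section \<open>Tensor powers of \<open>V = \<complex>\<^sup>2\<close>\<close>

text \<open>
  The k-th tensor power of V is the space of arrays indexed by sign tuples; the pure tensor
  of a family of vectors \<open>x j\<close> is the array of products of coordinates.
\<close>

type_synonym 'k tensor = "complex ^ ('k \<Rightarrow> bool)"

definition pure_tensor :: "('k::finite \<Rightarrow> complex ^ bool) \<Rightarrow> 'k tensor" where
  "pure_tensor x = (\<chi> r. \<Prod>j\<in>UNIV. x j $ r j)"

definition tvec :: "'k::finite tuple \<Rightarrow> 'k tensor" where
  "tvec r = pure_tensor (\<lambda>j. axis (r j) 1)"

text \<open>The diagonal action of a matrix is its k-fold Kronecker power, see \<open>tact_pure_tensor\<close>.\<close>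

definition tact :: "complex ^ bool ^ bool \<Rightarrow> 'k::finite tensor \<Rightarrow> 'k tensor" where
  "tact A x = (\<chi> r. \<Sum>s\<in>UNIV. (\<Prod>j\<in>UNIV. A $ r j $ s j) * x $ s)"

lemma tvec_eq_axis: "tvec r = axis r 1"
proof -
  have "(\<Prod>j\<in>UNIV. axis (r j) 1 $ s j) = (axis r 1 :: complex ^ ('a \<Rightarrow> bool)) $ s" for s
  proof (cases "r = s")
    case False
    then obtain j where "r j \<noteq> s j" by auto
    then have "(\<Prod>j\<in>UNIV. axis (r j) 1 $ s j) = (0::complex)"
      by (intro prod_zero) (auto simp: axis_def)
    then show ?thesis using False by (simp add: axis_def)
  qed (simp add: axis_def)
  then show ?thesis by (simp add: tvec_def pure_tensor_def vec_eq_iff)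
qed

lemma prod_sum_tuples:
  fixes a :: "'k::finite \<Rightarrow> bool \<Rightarrow> complex"
  shows "(\<Prod>j\<in>UNIV. \<Sum>b\<in>UNIV. a j b) = (\<Sum>s\<in>UNIV. \<Prod>j\<in>UNIV. a j (s j))"
  using prod_sum_PiE[of "UNIV :: 'k set" "\<lambda>_. UNIV" a] by (simp add: PiE_UNIV_domain)

lemma tact_pure_tensor: "tact A (pure_tensor x) = pure_tensor (\<lambda>j. A *v x j)"
proof -
  have "(\<Sum>s\<in>UNIV. (\<Prod>j\<in>UNIV. A $ r j $ s j) * (\<Prod>j\<in>UNIV. x j $ s j))
      = (\<Prod>j\<in>UNIV. \<Sum>b\<in>UNIV. A $ r j $ b * x j $ b)" for r :: "'a \<Rightarrow> bool"
    by (simp add: prod.distrib[symmetric] prod_sum_tuples)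
  then show ?thesis by (simp add: tact_def pure_tensor_def matrix_vector_mult_def vec_eq_iff)
qed

lemma linear_tact: "Vector_Spaces.linear (*s) (*s) (tact A)"
  by (rule Vector_Spaces.linear.intro)
     (unfold_locales, auto simp: tact_def vec_eq_iff algebra_simps sum.distrib sum_distrib_left)


section \<open>Linear operators, centralizer algebras and modules\<close>

type_synonym 'k operator = "'k tensor \<Rightarrow> 'k tensor"

definition op_scale :: "complex \<Rightarrow> 'k::finite operator \<Rightarrow> 'k operator" where
  "op_scale c X = (\<lambda>x. c *s X x)"

interpretation opr: vector_space "op_scale :: complex \<Rightarrow> 'k::finite operator \<Rightarrow> 'k operator"
  by unfold_locales (simp_all add: op_scale_def plus_fun_def vec.scale_right_distrib vec.scale_left_distrib)

definition centralizer :: "(complex ^ bool ^ bool) set \<Rightarrow> 'k::finite operator set" where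
  "centralizer G = {X. Vector_Spaces.linear (*s) (*s) X \<and> (\<forall>A\<in>G. X \<circ> tact A = tact A \<circ> X)}"

definition E_unit :: "'k::finite tuple \<Rightarrow> 'k tuple \<Rightarrow> 'k operator" where
  "E_unit r s = (\<lambda>x. x $ s *s tvec r)"

lemma E_unit_tvec: "E_unit r s (tvec t) = (if s = t then tvec r else 0)"
  by (auto simp: E_unit_def tvec_eq_axis axis_def vec_eq_iff)

lemma linear_E_unit: "Vector_Spaces.linear (*s) (*s) (E_unit r s)"
  by (rule Vector_Spaces.linear.intro)
     (unfold_locales, auto simp: E_unit_def vec_eq_iff algebra_simps)

definition e_unit :: "'k::finite tuple \<Rightarrow> 'k tuple \<Rightarrow> 'k operator" where
  "e_unit r s = E_unit r s + E_unit (- r) (- s)"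

definition i_inv_pow :: "nat \<Rightarrow> complex" where
  "i_inv_pow k = \<i> powi (- int k)"

text \<open>The two signs in the operators e+ and e- and in the vectors on which they act are
  given by the parameter \<open>\<sigma>\<close>, which is 1 or -1.\<close>

definition w_vec :: "complex \<Rightarrow> 'k::finite tuple \<Rightarrow> 'k tensor" where
  "w_vec \<sigma> t = tvec t + (\<sigma> * i_inv_pow CARD('k)) *s tvec (- t)"

definition e_pm :: "complex \<Rightarrow> 'k::finite tuple \<Rightarrow> 'k tuple \<Rightarrow> 'k operator" where
  "e_pm \<sigma> r s = op_scale (1/2) ((E_unit r s + E_unit (- r) (- s))
      + op_scale (\<sigma> * i_inv_pow CARD('k)) (E_unit r (- s) + E_unit (- r) s))"

text \<open>
  Since \<open>w_vec \<sigma> (- s)\<close> is a nonzero multiple of \<open>w_vec \<sigma> s\<close>, the rule that \<open>e_pm \<sigma> r s\<close> sends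
  \<open>w_vec \<sigma> t\<close> to \<open>w_vec \<sigma> r\<close> if \<open>t = s\<close> and to 0 otherwise cannot hold for \<open>t = - s\<close>.
\<close>

lemma i_inv_pow_even:
  assumes "even k" shows "i_inv_pow k * i_inv_pow k = 1"
proof -
  obtain m where "k = 2 * m" using assms by auto
  then have "\<i> ^ k * \<i> ^ k = (1 :: complex)"
    by (simp add: power_mult power_mult_distrib[symmetric])
  then show ?thesis
    unfolding i_inv_pow_def by (simp add: power_int_minus inverse_mult_distrib[symmetric] del: inverse_mult_distrib)
qed

lemma w_vec_uminus:
  fixes t :: "'k::finite tuple"
  assumes "even CARD('k)" "\<sigma> \<in> {1, - 1}"
  shows "w_vec \<sigma> (- t) = (\<sigma> * i_inv_pow CARD('k)) *s w_vec \<sigma> t"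
proof -
  have "(\<sigma> * i_inv_pow CARD('k)) * (\<sigma> * i_inv_pow CARD('k)) = 1"
    using i_inv_pow_even[OF assms(1)] assms(2) by auto
  then show ?thesis
    by (simp add: w_vec_def vec.scale_right_distrib add.commute)
qed

lemma e_pm_w_vec_opposite:
  fixes r s :: "'k::finite tuple"
  assumes "even CARD('k)" "\<sigma> \<in> {1, - 1}"
  shows "e_pm \<sigma> r s (w_vec \<sigma> s) = w_vec \<sigma> r"
    and "e_pm \<sigma> r s (w_vec \<sigma> (- s)) = (\<sigma> * i_inv_pow CARD('k)) *s w_vec \<sigma> r"
    and "(\<sigma> * i_inv_pow CARD('k)) *s w_vec \<sigma> r \<noteq> 0"
proof -
  let ?c = "\<sigma> * i_inv_pow CARD('k)"
  have c: "?c * ?c = 1"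
    using i_inv_pow_even[OF assms(1)] assms(2) by auto
  have s: "s \<noteq> - s" "- s \<noteq> s" "r \<noteq> - r" "- r \<noteq> r" by (auto simp: fun_eq_iff)
  have "?c * (?c * x) = x" for x using c by (simp add: mult.assoc[symmetric])
  then show 1: "e_pm \<sigma> r s (w_vec \<sigma> s) = w_vec \<sigma> r"
    using s c by (simp add: e_pm_def w_vec_def op_scale_def plus_fun_def E_unit_def tvec_eq_axis
        vec_eq_iff axis_def)
  have lin: "e_pm \<sigma> r s (a *s x) = a *s e_pm \<sigma> r s x" for a x
    by (simp add: e_pm_def op_scale_def plus_fun_def E_unit_def vec_eq_iff ring_distribs mult_ac)
  show "e_pm \<sigma> r s (w_vec \<sigma> (- s)) = ?c *s w_vec \<sigma> r"
    by (simp only: w_vec_uminus[OF assms] lin 1)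
  have "w_vec \<sigma> r $ r = 1" using s by (simp add: w_vec_def tvec_eq_axis axis_def)
  then show "?c *s w_vec \<sigma> r \<noteq> 0"
    using c by (metis mult_zero_left vec.scale_eq_0_iff zero_index zero_neq_one)
qed

definition irreducible_module :: "'k::finite operator set \<Rightarrow> 'k tensor set \<Rightarrow> bool" where
  "irreducible_module A W \<longleftrightarrow>
     vec.subspace W \<and> (\<forall>X\<in>A. X ` W \<subseteq> W) \<and> W \<noteq> {0} \<and>
     (\<forall>U. vec.subspace U \<and> U \<subseteq> W \<and> (\<forall>X\<in>A. X ` U \<subseteq> U) \<longrightarrow> U = {0} \<or> U = W)"

definition op_basis :: "'k::finite operator set \<Rightarrow> 'k operator set \<Rightarrow> bool" where
  "op_basis B W \<longleftrightarrow> opr.independent B \<and> opr.span B = W"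


section \<open>The planar rook algebra\<close>

text \<open>Strict monotonicity makes the partial maps injective.\<close>

typedef (overloaded) ('k::linorder) planar_rook =
  "{f :: 'k \<rightharpoonup> 'k. \<forall>i j a b. f i = Some a \<and> f j = Some b \<and> i < j \<longrightarrow> a < b}"
  by (rule exI[of _ Map.empty]) simp

setup_lifting type_definition_planar_rook

text \<open>
  The library's monoid algebras \<^typ>\<open>'m::monoid_add \<Rightarrow>\<^sub>0 complex\<close> (finitely supported functions
  with the convolution product) require additive notation for the monoid: here \<open>f + g\<close> is
  the composite partial map, first g and then f, and \<open>0\<close> is the identity map.
\<close>

instantiation planar_rook :: (linorder) monoid_add
begin

lift_definition zero_planar_rook :: "'a planar_rook" is Some by blast

lift_definition plus_planar_rook :: "'a planar_rook \<Rightarrow> 'a planar_rook \<Rightarrow> 'a planar_rook"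
  is "\<lambda>f g. f \<circ>\<^sub>m g"
proof -
  fix f g :: "'a \<rightharpoonup> 'a" and i j a b
  assume f: "\<And>i j a b. f i = Some a \<and> f j = Some b \<and> i < j \<Longrightarrow> a < b"
    and g: "\<And>i j a b. g i = Some a \<and> g j = Some b \<and> i < j \<Longrightarrow> a < b"
    and "(f \<circ>\<^sub>m g) i = Some a \<and> (f \<circ>\<^sub>m g) j = Some b \<and> i < j"
  then obtain a' b' where "g i = Some a'" "f a' = Some a" "g j = Some b'" "f b' = Some b" "i < j"
    unfolding map_comp_Some_iff by blast
  with f[of a' a b' b] g[of i a' j b'] show "a < b" by simp
qed

instance
proof
  fix a b c :: "'a planar_rook"
  show "a + b + c = a + (b + c)"
    by transfer (rule ext, simp (no_asm) add: map_comp_def split: option.split)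
  show "0 + a = a" by transfer (rule ext, simp (no_asm) add: map_comp_def split: option.split)
  show "a + 0 = a" by transfer (rule ext, simp (no_asm) add: map_comp_def)
qed

end

type_synonym 'k rook_algebra = "'k planar_rook \<Rightarrow>\<^sub>0 complex"

definition rook_scale :: "complex \<Rightarrow> 'k::linorder rook_algebra \<Rightarrow> 'k rook_algebra" where
  "rook_scale c p = Poly_Mapping.map (\<lambda>x. c * x) p"

lemma rook_scale_eq: "rook_scale c p = Poly_Mapping.single 0 c * p"
  by (simp add: rook_scale_def mult_map_scale_conv_mult)

lemma lookup_rook_scale:
  "Poly_Mapping.lookup (rook_scale c p) f = c * Poly_Mapping.lookup p f"
  by (simp add: rook_scale_def Poly_Mapping.map.rep_eq when_def)

interpretation rook: vector_space "rook_scale :: complex \<Rightarrow> 'k::linorder rook_algebra \<Rightarrow> _"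
  by unfold_locales
     (simp_all add: poly_mapping_eq_iff fun_eq_iff lookup_rook_scale lookup_add ring_distribs)

lemma single_0_comm: "p * Poly_Mapping.single 0 c = Poly_Mapping.single 0 c * (p :: 'k::linorder rook_algebra)"
proof -
  have eq: "p = (\<Sum>f\<in>Poly_Mapping.keys p. Poly_Mapping.single f (Poly_Mapping.lookup p f))"
    by (rule poly_mapping_eqI) (auto simp: lookup_sum lookup_single when_def in_keys_iff)
  show ?thesis
    by (subst eq, subst (3) eq) (simp add: sum_distrib_left sum_distrib_right mult_single mult.commute)
qed

lemma rook_scale_mult:
  "rook_scale c p * q = rook_scale c (p * q)" "p * rook_scale c q = rook_scale c (p * q)"
proof -
  show "rook_scale c p * q = rook_scale c (p * q)" by (simp add: rook_scale_eq mult.assoc)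
  have "p * rook_scale c q = (p * Poly_Mapping.single 0 c) * q"
    by (simp add: rook_scale_eq mult.assoc)
  then show "p * rook_scale c q = rook_scale c (p * q)"
    by (simp add: rook_scale_eq single_0_comm mult.assoc)
qed

definition rook_basis :: "'k::linorder rook_algebra set \<Rightarrow> 'k rook_algebra set \<Rightarrow> bool" where
  "rook_basis B W \<longleftrightarrow> rook.independent B \<and> rook.span B = W"

definition rook_matrix_units ::
    "('k::{finite,linorder} set \<Rightarrow> 'k set \<Rightarrow> 'k rook_algebra) \<Rightarrow> bool" where
  "rook_matrix_units X \<longleftrightarrow>
     rook_basis {X R S | R S. card R = card S} UNIV \<and>
     (\<forall>R S T U. card R = card S \<and> card T = card U \<longrightarrow>
        X R S * X T U = (if S = T then X R U else 0))"

text \<open>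
  A subalgebra need not contain the identity of the ambient algebra: the algebra
  \<open>Q_alg X\<close> below has an identity element of its own.
\<close>

definition rook_subalgebra :: "'k::linorder rook_algebra set \<Rightarrow> bool" where
  "rook_subalgebra Q \<longleftrightarrow> rook.subspace Q \<and> (\<forall>p\<in>Q. \<forall>q\<in>Q. p * q \<in> Q)"

definition Q_basis ::
    "('k::{finite,linorder} set \<Rightarrow> 'k set \<Rightarrow> 'k rook_algebra) \<Rightarrow> 'k rook_algebra set" where
  "Q_basis X =
     (if odd CARD('k)
      then {X R S | R S. card R = card S \<and> real (card S) \<le> (real CARD('k) - 1) / 2}
      else {X R S | R S. card R = card S \<and> real (card S) \<le> (real CARD('k) - 2) / 2}
         \<union> (\<Union>(R, S) \<in> {(R, S). card R = card S \<and> real (card S) = real CARD('k) / 2 \<and>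
                tuple_of_set R \<succ> tuple_of_set (- R) \<and> tuple_of_set S \<succ> tuple_of_set (- S)}.
              {X R S, X (- R) (- S)}))"

definition Q_alg ::
    "('k::{finite,linorder} set \<Rightarrow> 'k set \<Rightarrow> 'k rook_algebra) \<Rightarrow> 'k rook_algebra set" where
  "Q_alg X = rook.span (Q_basis X)"

text \<open>
  Isomorphism of complex algebras between an algebra of operators and a subalgebra of the
  planar rook algebra.  A multiplicative bijection preserves identity elements.
\<close>

definition algebra_iso :: "'k::finite operator set \<Rightarrow> 'l::linorder rook_algebra set \<Rightarrow> bool" where
  "algebra_iso Z Q \<longleftrightarrow> (\<exists>\<phi>. bij_betw \<phi> Z Q \<and>
     (\<forall>X\<in>Z. \<forall>Y\<in>Z. \<phi> (X + Y) = \<phi> X + \<phi> Y \<and> \<phi> (X \<circ> Y) = \<phi> X * \<phi> Y) \<and>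
     (\<forall>c. \<forall>X\<in>Z. \<phi> (op_scale c X) = rook_scale c (\<phi> X)))"


section \<open>Existence of matrix units in the planar rook algebra\<close>

text \<open>
  The predicate \<open>rook_matrix_units\<close> is satisfied by the Moebius transforms of the monoid
  elements: \<open>rook_unit R S\<close> is the alternating sum over all restrictions of the planar rook
  element with domain \<open>S\<close> and range \<open>R\<close>.
\<close>

lift_definition rook_restrict :: "'k::linorder planar_rook \<Rightarrow> 'k set \<Rightarrow> 'k planar_rook"
  is "\<lambda>f T. f |` T"
  by (auto simp: restrict_map_def split: if_splits)

lift_definition rook_dom :: "'k::linorder planar_rook \<Rightarrow> 'k set" is dom .
lift_definition rook_ran :: "'k::linorder planar_rook \<Rightarrow> 'k set" is ran .

definition rook_moebius :: "'k::{finite,linorder} planar_rook \<Rightarrow> 'k rook_algebra" where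
  "rook_moebius f = (\<Sum>T\<in>Pow (rook_dom f).
     Poly_Mapping.single (rook_restrict f T) ((- 1) ^ card (rook_dom f - T)))"

definition rook_unit :: "'k::{finite,linorder} set \<Rightarrow> 'k set \<Rightarrow> 'k rook_algebra" where
  "rook_unit R S = rook_moebius (THE f. rook_ran f = R \<and> rook_dom f = S)"

lemma sum_Pow_cancel:
  fixes F :: "'a set \<Rightarrow> 'b::ab_group_add"
  assumes D: "finite D" and j: "j \<in> D"
    and F: "\<And>T. T \<subseteq> D - {j} \<Longrightarrow> F (insert j T) = - F T"
  shows "(\<Sum>T\<in>Pow D. F T) = 0"
proof -
  let ?P = "Pow (D - {j})"
  have P: "Pow D = ?P \<union> insert j ` ?P" using j Pow_insert[of j "D - {j}"] by (simp add: insert_absorb)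
  have "inj_on (insert j) ?P" by (auto simp: inj_on_def)
  then have "sum F (insert j ` ?P) = (\<Sum>T\<in>?P. F (insert j T))" by (simp add: sum.reindex)
  also have "\<dots> = - sum F ?P" using F by (simp add: sum_negf)
  finally show ?thesis unfolding P using D by (subst sum.union_disjoint) auto
qed

lemma card_Diff_insert_sign:
  fixes D :: "'a::finite set"
  assumes "j \<in> D" "T \<subseteq> D - {j}"
  shows "(- 1 :: complex) ^ card (D - insert j T) = - ((- 1) ^ card (D - T))"
proof -
  have "D - T = insert j (D - insert j T)" using assms by auto
  then have "card (D - T) = Suc (card (D - insert j T))" by (metis Diff_iff card_insert_disjoint finite insertCI)
  then show ?thesis by simp
qed

lemma rook_restrict_dom: "rook_restrict f (rook_dom f) = f"
  by transfer (simp (no_asm) add: restrict_map_def dom_def fun_eq_iff)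

lemma rook_dom_restrict: "rook_dom (rook_restrict f T) = rook_dom f \<inter> T"
  by transfer (simp (no_asm))

lemma rook_ran_restrict_subset: "rook_ran (rook_restrict f T) \<subseteq> rook_ran f"
  by transfer (simp (no_asm) add: ran_restrictD ran_def restrict_map_def, blast)

lemma add_rook_restrict: "a + rook_restrict f T = rook_restrict (a + f) T"
  by transfer (simp (no_asm) add: restrict_map_def map_comp_def fun_eq_iff)

lemma rook_restrict_add:
  "rook_ran f \<subseteq> T \<Longrightarrow> rook_restrict g T + f = g + f"
proof transfer
  fix f g :: "'a \<rightharpoonup> 'a" and T assume "ran f \<subseteq> T"
  then have "f x = Some y \<Longrightarrow> y \<in> T" for x y by (auto simp: ran_def)
  then show "g |` T \<circ>\<^sub>m f = g \<circ>\<^sub>m f" by (intro ext) (auto simp: map_comp_def restrict_map_def split: option.split)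
qed

lemma rook_dom_add: "rook_ran f \<subseteq> rook_dom g \<Longrightarrow> rook_dom (g + f) = rook_dom f"
proof transfer
  fix f g :: "'a \<rightharpoonup> 'a" assume "ran f \<subseteq> dom g"
  then have "f x = Some y \<Longrightarrow> \<exists>z. g y = Some z" for x y by (auto simp: ran_def)
  then show "dom (g \<circ>\<^sub>m f) = dom f" by (fastforce simp: map_comp_def split: option.splits)
qed

lemma rook_ran_add: "rook_ran f = rook_dom g \<Longrightarrow> rook_ran (g + f) = rook_ran g"
proof transfer
  fix f g :: "'a \<rightharpoonup> 'a" assume eq: "ran f = dom g"
  show "ran (g \<circ>\<^sub>m f) = ran g"
  proof (intro equalityI subsetI)
    fix z assume "z \<in> ran g"
    then obtain y where y: "g y = Some z" by (auto simp: ran_def)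
    then have "y \<in> ran f" using eq by auto
    then obtain x where "f x = Some y" by (auto simp: ran_def)
    with y show "z \<in> ran (g \<circ>\<^sub>m f)" by (auto simp: ran_def map_comp_Some_iff)
  qed (auto simp: ran_def map_comp_Some_iff)
qed

lemma rook_restrict_add_insert:
  "j \<in> rook_dom f \<Longrightarrow> j \<notin> rook_dom (a + f) \<Longrightarrow> rook_restrict (a + f) (insert j T) = rook_restrict (a + f) T"
proof transfer
  fix f a :: "'a \<rightharpoonup> 'a" and j T assume "j \<notin> dom (a \<circ>\<^sub>m f)"
  then show "(a \<circ>\<^sub>m f) |` insert j T = (a \<circ>\<^sub>m f) |` T"
    by (intro ext) (simp add: restrict_map_def domIff)
qed

lemma rook_dom_addD: "rook_dom f \<subseteq> rook_dom (a + f) \<Longrightarrow> rook_ran f \<subseteq> rook_dom a"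
proof transfer
  fix f a :: "'a \<rightharpoonup> 'a" assume d: "dom f \<subseteq> dom (a \<circ>\<^sub>m f)"
  show "ran f \<subseteq> dom a"
  proof
    fix y assume "y \<in> ran f"
    then obtain x where x: "f x = Some y" by (auto simp: ran_def)
    then have "x \<in> dom (a \<circ>\<^sub>m f)" using d by auto
    then show "y \<in> dom a" using x by (auto simp: map_comp_Some_iff)
  qed
qed

lemma single_mult_moebius:
  "Poly_Mapping.single a c * rook_moebius f
    = (if rook_ran f \<subseteq> rook_dom a then rook_scale c (rook_moebius (a + f)) else 0)"
proof -
  have *: "Poly_Mapping.single a c * rook_moebius f = (\<Sum>T\<in>Pow (rook_dom f).
     Poly_Mapping.single (rook_restrict (a + f) T) (c * (- 1) ^ card (rook_dom f - T)))"
    by (simp add: rook_moebius_def sum_distrib_left mult_single add_rook_restrict)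
  show ?thesis
  proof (cases "rook_ran f \<subseteq> rook_dom a")
    case True
    then show ?thesis
      by (simp add: * rook_dom_add rook_moebius_def rook_scale_eq sum_distrib_left mult_single
          add_rook_restrict)
  next
    case False
    then obtain j where j: "j \<in> rook_dom f" "j \<notin> rook_dom (a + f)" using rook_dom_addD by blast
    have "Poly_Mapping.single a c * rook_moebius f = 0" unfolding *
      by (rule sum_Pow_cancel[OF finite j(1)])
         (simp add: rook_restrict_add_insert[OF j] card_Diff_insert_sign j(1) single_uminus)
    with False show ?thesis by simp
  qed
qed

lemma moebius_mult:
  "rook_moebius g * rook_moebius f = (if rook_ran f = rook_dom g then rook_moebius (g + f) else 0)"
proof -
  let ?D = "rook_dom g"
  let ?c = "\<lambda>T. if rook_ran f \<subseteq> T then (- 1 :: complex) ^ card (?D - T) else 0"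
  have "rook_moebius g * rook_moebius f
      = (\<Sum>T\<in>Pow ?D. Poly_Mapping.single (rook_restrict g T) ((- 1) ^ card (?D - T)) * rook_moebius f)"
    by (subst rook_moebius_def[of g]) (simp add: sum_distrib_right)
  also have "\<dots> = (\<Sum>T\<in>Pow ?D. rook_scale (?c T) (rook_moebius (g + f)))"
    by (intro sum.cong refl)
       (auto simp: single_mult_moebius rook_dom_restrict rook_restrict_add)
  also have "\<dots> = rook_scale (\<Sum>T\<in>Pow ?D. ?c T) (rook_moebius (g + f))"
    by (simp add: rook.scale_sum_left)
  also have "(\<Sum>T\<in>Pow ?D. ?c T) = (if rook_ran f = ?D then 1 else 0)"
  proof (cases "rook_ran f \<subset> ?D")
    case True
    then obtain j where j: "j \<in> ?D" "j \<notin> rook_ran f" by blast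
    have "(\<Sum>T\<in>Pow ?D. ?c T) = 0"
      by (rule sum_Pow_cancel[OF finite j(1)]) (use j in \<open>auto simp: card_Diff_insert_sign\<close>)
    with True show ?thesis by simp
  next
    case False
    have "(\<Sum>T\<in>Pow ?D. ?c T) = (\<Sum>T\<in>Pow ?D. if T = ?D then (if rook_ran f = ?D then 1 else 0) else 0)"
      by (intro sum.cong refl) (use False in auto)
    then show ?thesis by simp
  qed
  finally show ?thesis by simp
qed

lemma rook_exists_unique:
  fixes R S :: "'k::{finite,linorder} set"
  assumes "card R = card S"
  shows "\<exists>!f. rook_ran f = R \<and> rook_dom f = S"
proof -
  define rk where "rk A x = card {y\<in>A. y < x}" for A :: "'k set" and x
  have rk_less: "rk A x < rk A y" if "x \<in> A" "x < y" for A x y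
    unfolding rk_def using that by (intro psubset_card_mono) auto
  have rk_inj: "x = y" if "x \<in> A" "y \<in> A" "rk A x = rk A y" for A x y
    using rk_less that by (metis less_irrefl linorder_neqE)
  have rk_bij: "bij_betw (rk A) A {..<card A}" for A
  proof -
    have "inj_on (rk A) A" using rk_inj by (auto simp: inj_on_def)
    moreover have "rk A ` A \<subseteq> {..<card A}"
      by (auto simp: rk_def intro!: psubset_card_mono)
    ultimately show ?thesis
      by (metis bij_betw_def card_image card_lessThan card_subset_eq finite_lessThan)
  qed
  define f where "f = (\<lambda>x. if x \<in> S then Some (the_inv_into R (rk R) (rk S x)) else None)"
  have fR: "the_inv_into R (rk R) (rk S x) \<in> R" and rkf: "rk R (the_inv_into R (rk R) (rk S x)) = rk S x"
    if "x \<in> S" for x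
  proof -
    have "rk S x \<in> rk R ` R" using rk_bij[of R] rk_bij[of S] that assms by (auto simp: bij_betw_def)
    then show "the_inv_into R (rk R) (rk S x) \<in> R" "rk R (the_inv_into R (rk R) (rk S x)) = rk S x"
      using rk_bij[of R] by (auto simp: bij_betw_def intro: the_inv_into_into f_the_inv_into_f)
  qed
  have mono: "a < b" if "f i = Some a" "f j = Some b" "i < j" for i j a b
  proof -
    have ij: "i \<in> S" "j \<in> S" using that by (auto simp: f_def split: if_splits)
    have "rk R a < rk R b" using that rkf ij rk_less[of i S j] by (auto simp: f_def)
    moreover have "a \<in> R" "b \<in> R" using that fR ij by (auto simp: f_def)
    ultimately show ?thesis using rk_less[of b R a] by (metis less_asym linorder_neqE)
  qed
  have "dom f = S" by (auto simp: f_def split: if_splits)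
  moreover have "ran f = R"
  proof
    show "ran f \<subseteq> R" using fR by (auto simp: f_def ran_def split: if_splits)
    show "R \<subseteq> ran f"
    proof
      fix y assume y: "y \<in> R"
      then have "rk R y \<in> rk S ` S" using rk_bij[of R] rk_bij[of S] assms by (auto simp: bij_betw_def)
      then obtain x where x: "x \<in> S" "rk S x = rk R y" by auto
      then have "f x = Some y" using rk_inj[OF fR[OF x(1)] y] rkf[OF x(1)] by (simp add: f_def)
      then show "y \<in> ran f" by (auto simp: ran_def)
    qed
  qed
  moreover have "Rep_planar_rook (Abs_planar_rook f) = f"
    by (rule Abs_planar_rook_inverse) (use mono in blast)
  ultimately have ex: "rook_ran (Abs_planar_rook f) = R \<and> rook_dom (Abs_planar_rook f) = S"
    by (simp add: rook_dom.rep_eq rook_ran.rep_eq)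
  have rk_pres: "rk R b = rk S x" if h: "rook_ran h = R" "rook_dom h = S" "Rep_planar_rook h x = Some b"
    for h x b
  proof -
    let ?h = "Rep_planar_rook h"
    have m: "a < b" if "?h i = Some a" "?h j = Some b" "i < j" for i j a b
      using Rep_planar_rook[of h] that by blast
    have d: "dom ?h = S" "ran ?h = R" using h by (simp_all add: rook_dom.rep_eq rook_ran.rep_eq)
    have "bij_betw (\<lambda>y. the (?h y)) {y\<in>S. y < x} {y\<in>R. y < b}"
    proof (rule bij_betw_imageI)
      show "inj_on (\<lambda>y. the (?h y)) {y\<in>S. y < x}"
      proof (rule inj_onI)
        fix u v assume uv: "u \<in> {y\<in>S. y < x}" "v \<in> {y\<in>S. y < x}" "the (?h u) = the (?h v)"
        then obtain a where "?h u = Some a" "?h v = Some a" using d(1) by auto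
        then show "u = v" using m by (metis less_irrefl linorder_neqE)
      qed
      show "(\<lambda>y. the (?h y)) ` {y\<in>S. y < x} = {y\<in>R. y < b}"
      proof (intro equalityI subsetI)
        fix c assume "c \<in> (\<lambda>y. the (?h y)) ` {y\<in>S. y < x}"
        then obtain y where y: "y \<in> S" "y < x" "c = the (?h y)" by auto
        then have "?h y = Some c" using d(1) by auto
        then show "c \<in> {y\<in>R. y < b}" using m[OF _ h(3)] y d(2) by (auto simp: ran_def)
      next
        fix c assume c: "c \<in> {y\<in>R. y < b}"
        then obtain y where y: "?h y = Some c" using d(2) by (auto simp: ran_def)
        have "y < x"
        proof (rule ccontr)
          assume "\<not> y < x"
          then have "x < y \<or> x = y" by auto
          then have "b < c \<or> b = c" using m[OF h(3) y] h(3) y by auto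
          with c show False by auto
        qed
        with y d(1) show "c \<in> (\<lambda>y. the (?h y)) ` {y\<in>S. y < x}" by force
      qed
    qed
    then show ?thesis unfolding rk_def by (metis bij_betw_same_card)
  qed
  show ?thesis
  proof (rule ex1I[of _ "Abs_planar_rook f"], rule ex)
    fix h assume h: "rook_ran h = R \<and> rook_dom h = S"
    let ?k = "Abs_planar_rook f"
    have dh: "dom (Rep_planar_rook h) = S" "ran (Rep_planar_rook h) = R"
      and dk: "dom (Rep_planar_rook ?k) = S" "ran (Rep_planar_rook ?k) = R"
      using h ex by (simp_all only: rook_dom.rep_eq[symmetric] rook_ran.rep_eq[symmetric])
    have "Rep_planar_rook h x = Rep_planar_rook ?k x" for x
    proof (cases "x \<in> S")
      case False
      then have "x \<notin> dom (Rep_planar_rook h)" "x \<notin> dom (Rep_planar_rook ?k)"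
        by (simp_all only: dh dk not_False_eq_True)
      then show ?thesis by (simp only: domIff not_not)
    next
      case True
      then have "x \<in> dom (Rep_planar_rook h)" "x \<in> dom (Rep_planar_rook ?k)"
        by (simp_all only: dh dk)
      then obtain a b where ab: "Rep_planar_rook h x = Some a" "Rep_planar_rook ?k x = Some b"
        by blast
      then have "a \<in> R" "b \<in> R" using dh(2) dk(2) by (blast intro: ranI)+
      moreover have "rk R a = rk S x" by (rule rk_pres[of h]) (use h ab in blast)+
      moreover have "rk R b = rk S x" by (rule rk_pres[of ?k]) (use ex ab in blast)+
      ultimately have "a = b" using rk_inj[of a R b] by simp
      with ab show ?thesis by (simp only:)
    qed
    then have "Rep_planar_rook h = Rep_planar_rook ?k" by (rule ext)
    then show "h = ?k" by (simp only: Rep_planar_rook_inject)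
  qed
qed

lemma card_rook_ran: "card (rook_ran f) = card (rook_dom f)" for f :: "'k::{finite,linorder} planar_rook"
proof -
  let ?f = "Rep_planar_rook f"
  have m: "a < b" if "?f i = Some a" "?f j = Some b" "i < j" for i j a b
    using Rep_planar_rook[of f] that by blast
  have "inj_on (\<lambda>y. the (?f y)) (dom ?f)"
  proof (rule inj_onI)
    fix u v assume uv: "u \<in> dom ?f" "v \<in> dom ?f" "the (?f u) = the (?f v)"
    then obtain a where "?f u = Some a" "?f v = Some a" by auto
    then show "u = v" using m by (metis less_irrefl linorder_neqE)
  qed
  moreover have "(\<lambda>y. the (?f y)) ` dom ?f = ran ?f" by (force simp: ran_def)
  ultimately show ?thesis by (metis card_image rook_dom.rep_eq rook_ran.rep_eq)
qed

lemma rook_unit_moebius: "rook_moebius f = rook_unit (rook_ran f) (rook_dom f)"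
  unfolding rook_unit_def
  using the1_equality[OF rook_exists_unique[OF card_rook_ran[of f]]] by metis

lemma rook_unit_cases:
  assumes "card R = card S"
  obtains f where "rook_ran f = R" "rook_dom f = S" "rook_unit R S = rook_moebius f"
  using rook_exists_unique[OF assms] rook_unit_moebius by metis

lemma rook_unit_mult:
  assumes "card R = card S" "card T = card U"
  shows "rook_unit R S * rook_unit T U = (if S = T then rook_unit R U else 0)"
proof -
  obtain g where g: "rook_ran g = R" "rook_dom g = S" "rook_unit R S = rook_moebius g"
    using rook_unit_cases[OF assms(1)] .
  obtain f where f: "rook_ran f = T" "rook_dom f = U" "rook_unit T U = rook_moebius f"
    using rook_unit_cases[OF assms(2)] .
  show ?thesis
    using g f rook_unit_moebius[of "g + f"] by (auto simp: moebius_mult rook_ran_add rook_dom_add)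
qed

lemma moebius_split:
  "rook_moebius f = Poly_Mapping.single f 1 + (\<Sum>T\<in>Pow (rook_dom f) - {rook_dom f}.
     Poly_Mapping.single (rook_restrict f T) ((- 1) ^ card (rook_dom f - T)))"
  unfolding rook_moebius_def by (subst sum.remove[of _ "rook_dom f"]) (auto simp: rook_restrict_dom)

lemma moebius_nonzero: "rook_moebius f \<noteq> 0"
proof
  assume 0: "rook_moebius f = 0"
  have "rook_restrict f T \<noteq> f" if "T \<in> Pow (rook_dom f) - {rook_dom f}" for T
    using that rook_dom_restrict[of f T] by auto
  then have "Poly_Mapping.lookup (rook_moebius f) f = 1"
    unfolding moebius_split by (simp add: lookup_add lookup_sum lookup_single when_def)
  with 0 show False by simp
qed

lemma rook_matrix_units_rook_unit:
  "rook_matrix_units (rook_unit :: 'k::{finite,linorder} set \<Rightarrow> 'k set \<Rightarrow> 'k rook_algebra)"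
proof -
  let ?B = "{rook_unit R S | R S :: 'k set. card R = card S}"
  have "rook.independent ?B"
    unfolding rook.independent_explicit_module
  proof (intro allI impI)
    fix t u and v :: "'k rook_algebra"
    assume t: "finite t" "t \<subseteq> ?B" "(\<Sum>v\<in>t. rook_scale (u v) v) = 0" "v \<in> t"
    then obtain R S where RS: "card R = card S" "v = rook_unit R S" by blast
    have "rook_unit R R * w * rook_unit S S = (if w = v then v else 0)" if wt: "w \<in> t" for w
    proof -
      obtain R' S' where w: "card R' = card S'" "w = rook_unit R' S'" using t(2) wt by blast
      have "v \<noteq> 0" using RS moebius_nonzero rook_unit_cases by metis
      have P: "rook_unit R R * rook_unit A B * rook_unit S S
          = (if A = R \<and> B = S then rook_unit R S else 0)" if "card A = card B" for A B
        using that RS(1) by (simp add: rook_unit_mult)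
      show ?thesis
      proof (cases "R' = R \<and> S' = S")
        case True
        then show ?thesis using P[OF w(1)] w(2) RS(2) by simp
      next
        case False
        then have 0: "rook_unit R R * w * rook_unit S S = 0"
          unfolding w(2) P[OF w(1)] by (rule if_not_P)
        moreover have "rook_unit R R * v * rook_unit S S = v" using P[OF RS(1)] RS(2) by simp
        ultimately have "w \<noteq> v" using \<open>v \<noteq> 0\<close> by metis
        with 0 show ?thesis by simp
      qed
    qed
    then have "rook_unit R R * (\<Sum>v\<in>t. rook_scale (u v) v) * rook_unit S S
        = (\<Sum>w\<in>t. if w = v then rook_scale (u v) v else 0)"
      by (auto simp: sum_distrib_left sum_distrib_right rook_scale_mult intro!: sum.cong)
    then have "rook_scale (u v) v = 0" using t by simp
    moreover have "v \<noteq> 0" using RS moebius_nonzero rook_unit_cases by metis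
    ultimately show "u v = 0" by simp
  qed
  moreover have "rook.span ?B = UNIV"
  proof -
    have s: "Poly_Mapping.single f c \<in> rook.span ?B" for f :: "'k planar_rook" and c
    proof (induction "card (rook_dom f)" arbitrary: f c rule: less_induct)
      case less
      let ?r = "\<Sum>T\<in>Pow (rook_dom f) - {rook_dom f}.
          Poly_Mapping.single (rook_restrict f T) ((- 1 :: complex) ^ card (rook_dom f - T))"
      have "?r \<in> rook.span ?B"
        by (intro rook.span_sum less) (auto simp: rook_dom_restrict intro!: psubset_card_mono)
      moreover have "rook_moebius f \<in> rook.span ?B"
        unfolding rook_unit_moebius using card_rook_ran[of f] by (intro rook.span_base) auto
      ultimately have "rook_moebius f - ?r \<in> rook.span ?B" by (rule rook.span_diff[rotated])
      then have "Poly_Mapping.single f 1 \<in> rook.span ?B" by (simp add: moebius_split)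
      then have "rook_scale c (Poly_Mapping.single f 1) \<in> rook.span ?B" by (rule rook.span_scale)
      then show ?case by (simp add: rook_scale_eq mult_single)
    qed
    have "p \<in> rook.span ?B" for p :: "'k rook_algebra"
    proof -
      have eq: "p = (\<Sum>f\<in>Poly_Mapping.keys p. Poly_Mapping.single f (Poly_Mapping.lookup p f))"
        by (rule poly_mapping_eqI) (auto simp: lookup_sum lookup_single when_def in_keys_iff)
      show ?thesis by (subst eq) (intro rook.span_sum s)
    qed
    then show ?thesis by auto
  qed
  ultimately show ?thesis
    unfolding rook_matrix_units_def rook_basis_def using rook_unit_mult by blast
qed

end

theory Submission
  imports Defs
begin

text \<open>
  In the basis \<open>tvec r\<close> of the tensor power, with \<open>k\<close> factors, the generator \<open>g\<close> is diagonal with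
  eigenvalue \<open>\<zeta>\<close> to the power \<open>k - 2 wt r\<close>.  As \<open>\<zeta>\<close> is not a root of unity, these powers
  are distinct for distinct weights, so an operator commutes with \<open>g\<close> precisely when its matrix
  preserves the weight.  The generator \<open>h\<close> sends \<open>tvec r\<close> to \<open>\<i> ^ k\<close> times \<open>tvec (- r)\<close>,
  so an operator commutes with \<open>h\<close> precisely when its matrix is unchanged by negating both
  indices (\<open>commutes_with_g_iff\<close>, \<open>commutes_with_h_iff\<close>).  Commuting with a group means commuting
  with its generators (\<open>centralizer_generate\<close>), so both centralizers are explicit spaces of
  matrices.

  The basis and the dimension follow: negation acts without fixed points on the pairs of tuples
  of equal weight, of which there are \<open>2 k choose k\<close>, and the pairs whose first member is
  positive, \<open>r \<succ> - r\<close>, represent its orbits.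

  Negation maps weight \<open>b\<close> to weight \<open>k - b\<close>.  A weight class below the middle therefore carries
  a full matrix algebra with units \<open>e_unit r s\<close>.  The middle class, present for even \<open>k\<close>, splits
  into the two eigenspaces of \<open>h\<close>, which are spanned by the vectors \<open>w_vec \<sigma> t\<close> for
  \<open>\<sigma> = 1\<close> and \<open>\<sigma> = - 1\<close> and have the matrix units \<open>e_pm \<sigma> r s\<close>.  A module spanned by
  vectors on which matrix units act is irreducible (\<open>matrix_units_irreducible\<close>).

  Together these blocks exhaust the centralizer, which is thus a direct sum of matrix algebras.
  The algebra \<open>Q_alg X\<close> is spanned by matrix units for blocks of the same sizes: one block for each
  size of subsets below \<open>k / 2\<close>, and two blocks, indexed by the positive subsets and by their
  complements, in size \<open>k / 2\<close>.  Sending an operator to its matrices on the irreducible modules is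
  the isomorphism (\<open>algebra_iso_matrix_units\<close>).
\<close>

section \<open>Dual functionals\<close>

lemma (in vector_space) independent_family_dual:
  fixes b :: "'i \<Rightarrow> 'b" and f :: "'i \<Rightarrow> 'b \<Rightarrow> 'a"
  assumes I: "finite I"
    and add: "\<And>i x y. i \<in> I \<Longrightarrow> f i (x + y) = f i x + f i y"
    and hom: "\<And>i c x. i \<in> I \<Longrightarrow> f i (c *s x) = c * f i x"
    and dual: "\<And>i j. i \<in> I \<Longrightarrow> j \<in> I \<Longrightarrow> f i (b j) = (if i = j then 1 else 0)"
  shows "independent (b ` I)" and "dim (span (b ` I)) = card I"
proof -
  have inj: "inj_on b I"
    using dual by (intro inj_onI) (metis zero_neq_one)
  have f0: "f i 0 = 0" if "i \<in> I" for i
    using hom[OF that, of 0 0] by simp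
  have fsum: "f i (sum g A) = (\<Sum>a\<in>A. f i (g a))" if "i \<in> I" for i and g :: "'i \<Rightarrow> 'b" and A
    by (induction A rule: infinite_finite_induct) (simp_all add: f0 add that)
  show ind: "independent (b ` I)"
  proof (rule independent_if_scalars_zero)
    fix c x assume 0: "(\<Sum>x\<in>b ` I. c x *s x) = 0" and "x \<in> b ` I"
    then obtain i where i: "i \<in> I" "x = b i" by blast
    have "0 = f i (\<Sum>j\<in>I. c (b j) *s b j)"
      using 0 f0[OF i(1)] by (simp add: sum.reindex[OF inj])
    also have "\<dots> = (\<Sum>j\<in>I. if i = j then c (b i) else 0)"
      unfolding fsum[OF i(1)] by (rule sum.cong[OF refl]) (simp add: hom[OF i(1)] dual[OF i(1)])
    finally show "c x = 0" using I i by simp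
  qed (use I in simp)
  show "dim (span (b ` I)) = card I"
    using dim_span_eq_card_independent[OF ind] card_image[OF inj] by simp
qed

text \<open>
  Subtracting from a vector of \<open>W\<close> the combination of the \<open>b i\<close> with coefficients \<open>f i x\<close>
  leaves a vector of \<open>W\<close> on which all functionals vanish; so functionals that are dual to the
  \<open>b i\<close> and separate the points of \<open>W\<close> settle both spanning and independence.  For spaces
  of operators the functionals below are matrix entries.
\<close>

lemma (in vector_space) dual_family_basis:
  fixes b :: "'i \<Rightarrow> 'b" and f :: "'i \<Rightarrow> 'b \<Rightarrow> 'a"
  assumes I: "finite I"
    and add: "\<And>i x y. i \<in> I \<Longrightarrow> f i (x + y) = f i x + f i y"
    and hom: "\<And>i c x. i \<in> I \<Longrightarrow> f i (c *s x) = c * f i x"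
    and dual: "\<And>i j. i \<in> I \<Longrightarrow> j \<in> I \<Longrightarrow> f i (b j) = (if i = j then 1 else 0)"
    and W: "subspace W" "\<And>i. i \<in> I \<Longrightarrow> b i \<in> W"
    and sep: "\<And>x. x \<in> W \<Longrightarrow> \<forall>i\<in>I. f i x = 0 \<Longrightarrow> x = 0"
  shows "independent (b ` I)" and "span (b ` I) = W" and "dim W = card I"
proof -
  show "independent (b ` I)"
    by (rule independent_family_dual(1)[where f = f, OF I add hom dual])
  have "x \<in> span (b ` I)" if x: "x \<in> W" for x
  proof -
    let ?y = "\<Sum>j\<in>I. f j x *s b j"
    have y: "?y \<in> W" using W by (intro subspace_sum subspace_scale)
    have "f i (x - ?y) = 0" if i: "i \<in> I" for i
    proof -
      have f0: "f i 0 = 0" using hom[OF i, of 0 0] by simp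
      have fsum: "f i (sum g A) = (\<Sum>a\<in>A. f i (g a))" for g :: "'i \<Rightarrow> 'b" and A
        by (induction A rule: infinite_finite_induct) (simp_all add: f0 add[OF i])
      have "f i ?y = (\<Sum>j\<in>I. if i = j then f i x else 0)"
        unfolding fsum by (rule sum.cong[OF refl]) (simp add: hom[OF i] dual[OF i])
      then have "f i ?y = f i x" using I i by simp
      moreover have "f i (x - ?y) + f i ?y = f i x" using add[OF i, of "x - ?y" ?y] by simp
      ultimately show ?thesis by simp
    qed
    then have "x - ?y = 0" using sep subspace_diff[OF W(1) x y] by blast
    then have "x = ?y" by simp
    also have "?y \<in> span (b ` I)" by (intro span_sum span_scale span_base) simp
    finally show ?thesis .
  qed
  then show span: "span (b ` I) = W"
    using span_minimal[OF _ W(1), of "b ` I"] W(2) by blast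
  show "dim W = card I"
    using independent_family_dual(2)[where f = f, OF I add hom dual] span by simp
qed

section \<open>Linear operators and modules over matrix units\<close>

abbreviation linear_op :: "'k::finite operator \<Rightarrow> bool" where
  "linear_op X \<equiv> Vector_Spaces.linear (*s) (*s) X"

lemma linear_op_iff:
  "linear_op X \<longleftrightarrow> (\<forall>x y. X (x + y) = X x + X y) \<and> (\<forall>c x. X (c *s x) = c *s X x)"
  by (auto simp: Vector_Spaces.linear_iff vec.vector_space_axioms)

lemma linear_op_add: "linear_op X \<Longrightarrow> X (x + y) = X x + X y"
  and linear_op_scale: "linear_op X \<Longrightarrow> X (c *s x) = c *s X x"
  by (auto simp: linear_op_iff)

lemma linear_op_0: "linear_op X \<Longrightarrow> X 0 = 0"
  using linear_op_scale[of X 0 0] by simp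

lemma linear_op_sum: "linear_op X \<Longrightarrow> X (sum f A) = (\<Sum>a\<in>A. X (f a))"
  by (induction A rule: infinite_finite_induct) (simp_all add: linear_op_0 linear_op_add)

lemma linear_op_comp: "linear_op X \<Longrightarrow> linear_op Y \<Longrightarrow> linear_op (X \<circ> Y)"
  by (simp add: linear_op_iff)

lemma tvec_component: "tvec r $ s = (if s = r then 1 else 0)"
  by (simp add: tvec_eq_axis axis_def)

lemma tensor_expansion: "x = (\<Sum>s\<in>UNIV. (x $ s) *s tvec s)"
  by (simp add: vec_eq_iff tvec_component if_distrib cong: if_cong)

lemma linear_op_component:
  assumes "linear_op X"
  shows "X x $ r = (\<Sum>s\<in>UNIV. x $ s * X (tvec s) $ r)"
proof -
  have "X x = (\<Sum>s\<in>UNIV. x $ s *s X (tvec s))"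
    by (subst tensor_expansion[of x]) (simp add: linear_op_sum linear_op_scale assms)
  then show ?thesis by simp
qed

lemma linear_op_eqI:
  assumes "linear_op X" "linear_op Y" "\<And>r s. X (tvec s) $ r = Y (tvec s) $ r"
  shows "X = Y"
proof
  fix x
  have "X x $ r = Y x $ r" for r
    by (simp only: linear_op_component[OF assms(1), of x r] linear_op_component[OF assms(2), of x r]
        assms(3))
  then show "X x = Y x" by (simp add: vec_eq_iff)
qed

lemma span_image_expansion:
  assumes "finite I" "x \<in> vec.span (u ` I)"
  obtains a where "x = (\<Sum>i\<in>I. a i *s u i)"
  using assms(2)
proof (induction arbitrary: thesis rule: vec.span_induct_alt)
  case base
  show ?case by (rule base[of "\<lambda>_. 0"]) simp
next
  case (step c y z)
  then obtain j a where j: "j \<in> I" "y = u j" and a: "z = (\<Sum>i\<in>I. a i *s u i)" by blast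
  have "c *s y = (\<Sum>i\<in>I. (if i = j then c else 0) *s u i)"
    using assms(1) j by (simp add: if_distrib[of "\<lambda>c. c *s _"] cong: if_cong)
  then have "c *s y + z = (\<Sum>i\<in>I. ((if i = j then c else 0) + a i) *s u i)"
    by (simp add: a sum.distrib vec.scale_left_distrib)
  then show ?case by (rule step.prems)
qed

text \<open>
  The matrix units act on the span of the \<open>u i\<close> as the full matrix algebra: from any nonzero
  vector, one unit extracts a nonzero multiple of any chosen \<open>u i\<close>.  Reading off a nonzero
  coordinate of \<open>u i\<close> after applying \<open>F i j\<close>, with \<open>i\<close> fixed, gives a functional dual to
  \<open>u j\<close>, hence the dimension.
\<close>

lemma matrix_units_irreducible:
  fixes u :: "'i \<Rightarrow> 'k::finite tensor" and F :: "'i \<Rightarrow> 'i \<Rightarrow> 'k operator"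
  assumes I: "finite I" "I \<noteq> {}"
    and lin: "\<And>X. X \<in> A \<Longrightarrow> linear_op X"
    and inv: "\<And>X j. X \<in> A \<Longrightarrow> j \<in> I \<Longrightarrow> X (u j) \<in> vec.span (u ` I)"
    and nz: "\<And>i. i \<in> I \<Longrightarrow> u i \<noteq> 0"
    and F: "\<And>i j. i \<in> I \<Longrightarrow> j \<in> I \<Longrightarrow> F i j \<in> A"
    and Fu: "\<And>i j l. i \<in> I \<Longrightarrow> j \<in> I \<Longrightarrow> l \<in> I \<Longrightarrow> F i j (u l) = (if j = l then u i else 0)"
  shows "irreducible_module A (vec.span (u ` I))" and "vec.dim (vec.span (u ` I)) = card I"
proof -
  let ?W = "vec.span (u ` I)"
  have linF: "linear_op (F i j)" if "i \<in> I" "j \<in> I" for i j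
    using lin F that by blast
  have "\<forall>X\<in>A. X ` ?W \<subseteq> ?W"
  proof (intro ballI subsetI, elim imageE)
    fix X x y assume X: "X \<in> A" and x: "x \<in> ?W" and y: "y = X x"
    obtain a where "x = (\<Sum>i\<in>I. a i *s u i)" using span_image_expansion[OF I(1) x] .
    then have "y = (\<Sum>i\<in>I. a i *s X (u i))"
      by (simp add: y linear_op_sum[OF lin[OF X]] linear_op_scale[OF lin[OF X]])
    then show "y \<in> ?W" using inv[OF X] by (auto intro!: vec.span_sum vec.span_scale)
  qed
  moreover have "?W \<noteq> {0}"
    using I(2) nz vec.span_base[of _ "u ` I"] by blast
  moreover have "U = {0} \<or> U = ?W"
    if U: "vec.subspace U" "U \<subseteq> ?W" "\<forall>X\<in>A. X ` U \<subseteq> U" for U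
  proof (rule disjCI)
    assume "U \<noteq> ?W"
    show "U = {0}"
    proof (rule ccontr)
      assume "U \<noteq> {0}"
      then obtain x where x: "x \<in> U" "x \<noteq> 0" using vec.subspace_0[OF U(1)] by blast
      then obtain a where a: "x = (\<Sum>i\<in>I. a i *s u i)"
        using span_image_expansion[OF I(1)] U(2) by blast
      then obtain j where j: "j \<in> I" "a j \<noteq> 0"
        using x(2) by (metis (no_types, lifting) sum.neutral vec.scale_zero_left)
      have "u i \<in> U" if i: "i \<in> I" for i
      proof -
        have "F i j x = (\<Sum>l\<in>I. if l = j then a j *s u i else 0)"
          unfolding a linear_op_sum[OF linF[OF i j(1)]]
          by (rule sum.cong[OF refl]) (simp add: linear_op_scale[OF linF[OF i j(1)]] Fu i j)
        then have "F i j x = a j *s u i" using I(1) j(1) by simp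
        moreover have "F i j x \<in> U" using U(3) F[OF i j(1)] x(1) by blast
        ultimately have "inverse (a j) *s (a j *s u i) \<in> U" using vec.subspace_scale[OF U(1)] by metis
        then show ?thesis using j(2) by simp
      qed
      then have "?W \<subseteq> U" using U(1) by (intro vec.span_minimal) auto
      with U(2) \<open>U \<noteq> ?W\<close> show False by blast
    qed
  qed
  ultimately show "irreducible_module A ?W"
    by (auto simp: irreducible_module_def vec.subspace_span)
  obtain i where i: "i \<in> I" using I(2) by blast
  obtain p where p: "u i $ p \<noteq> 0" using nz[OF i] by (auto simp: vec_eq_iff)
  show "vec.dim ?W = card I"
  proof (rule vec.independent_family_dual(2)[where f = "\<lambda>j x. F i j x $ p / u i $ p", OF I(1)])
    fix j l assume "j \<in> I" "l \<in> I"
    then show "F i j (u l) $ p / u i $ p = (if j = l then 1 else 0)" using Fu[OF i] p by simp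
  qed (simp_all add: linear_op_add[OF linF[OF i]] linear_op_scale[OF linF[OF i]] add_divide_distrib)
qed

section \<open>The centralizers in terms of matrix entries\<close>

lemma tact_mult: "tact (A ** B) = tact A \<circ> tact B"
proof (rule linear_op_eqI)
  fix r s :: "'a tuple"
  have "tact (A ** B) (tvec s) = tact A (tact B (tvec s))"
    by (simp add: tvec_def tact_pure_tensor matrix_vector_mul_assoc)
  then show "tact (A ** B) (tvec s) $ r = (tact A \<circ> tact B) (tvec s) $ r" by simp
qed (intro linear_tact linear_op_comp)+

lemma tact_mat_1: "tact (mat 1) = id"
proof (rule linear_op_eqI)
  fix r s :: "'a tuple"
  have "tact (mat 1) (tvec s) = tvec s" by (simp add: tvec_def tact_pure_tensor)
  then show "tact (mat 1) (tvec s) $ r = id (tvec s) $ r" by simp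
qed (rule linear_tact, simp add: linear_op_iff)

text \<open>
  Commuting with the diagonal action is inherited by products and inverses because the
  diagonal action is multiplicative.
\<close>

lemma centralizer_generate:
  assumes "S \<subseteq> carrier SU2"
  shows "(centralizer (generate SU2 S) :: 'k::finite operator set) = centralizer S"
proof (intro equalityI subsetI)
  fix X :: "'k operator" assume "X \<in> centralizer (generate SU2 S)"
  then show "X \<in> centralizer S" by (auto simp: centralizer_def intro: generate.incl)
next
  fix X :: "'k operator" assume X: "X \<in> centralizer S"
  have "X \<circ> tact A = tact A \<circ> X" if "A \<in> generate SU2 S" for A
    using that
  proof (induction rule: generate.induct)
    case one
    then show ?case by (simp add: SU2_def tact_mat_1)
  next
    case (incl A)
    then show ?case using X by (simp add: centralizer_def)
  next
    case (inv A)
    let ?B = "inv\<^bsub>SU2\<^esub> A"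
    interpret group SU2 by (rule group_SU2)
    have A: "A \<in> carrier SU2" using inv assms by blast
    have "A ** ?B = mat 1" "?B ** A = mat 1"
      using r_inv[OF A] l_inv[OF A] by (simp_all add: SU2_def)
    then have AB: "tact A \<circ> tact ?B = (id :: 'k operator)" "tact ?B \<circ> tact A = (id :: 'k operator)"
      by (simp_all add: tact_mult[symmetric] tact_mat_1)
    have XA: "X \<circ> tact A = tact A \<circ> X" using X inv by (simp add: centralizer_def)
    have "X \<circ> tact ?B = tact ?B \<circ> (tact A \<circ> X) \<circ> tact ?B"
      by (simp add: AB comp_assoc[symmetric])
    also have "\<dots> = tact ?B \<circ> X \<circ> (tact A \<circ> tact ?B)"
      by (simp add: XA[symmetric] comp_assoc)
    finally show ?case by (simp add: AB)
  next
    case (eng A B)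
    have "X (tact A x) = tact A (X x)" "X (tact B x) = tact B (X x)" for x
      using eng.IH by (simp_all only: fun_eq_iff comp_apply)
    then show ?case by (simp add: SU2_def tact_mult fun_eq_iff)
  qed
  with X show "X \<in> centralizer (generate SU2 S)" by (simp add: centralizer_def)
qed

lemma uminus_tuple_ne: "- r \<noteq> (r :: 'k tuple)" "r \<noteq> - r"
  by (auto simp: fun_eq_iff)

lemma wt_le: "wt (r :: 'k::finite tuple) \<le> CARD('k)"
  unfolding wt_def by (rule card_mono) auto

lemma wt_uminus: "wt (- r) = CARD('k) - wt (r :: 'k::finite tuple)"
proof -
  have "{j. (- r) j = False} = - {j. r j = False}" by auto
  then show ?thesis unfolding wt_def by (simp add: Compl_eq_Diff_UNIV card_Diff_subset)
qed

lemma wt_add_uminus: "wt r + wt (- r) = CARD('k)" for r :: "'k::finite tuple"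
  using wt_uminus[of r] wt_le[of r] by simp

definition g_eigenvalue :: "complex \<Rightarrow> 'k::finite tuple \<Rightarrow> complex" where
  "g_eigenvalue z r = z ^ wt (- r) * inverse z ^ wt r"

lemma tact_g_component: "tact (g_mat z) x $ r = g_eigenvalue z r * x $ r"
proof -
  have "(\<Prod>j\<in>UNIV. g_mat z $ r j $ s j) = (if s = r then g_eigenvalue z r else 0)" for s
  proof (cases "s = r")
    case True
    have "(\<Prod>j\<in>UNIV. g_mat z $ r j $ r j)
        = (\<Prod>j\<in>UNIV. if (- r) j = False then z else inverse z)"
      by (simp add: g_mat_def)
    also have "\<dots> = z ^ wt (- r) * inverse z ^ wt r"
      by (subst prod.If_cases) (simp_all add: wt_def Compl_eq Collect_neg_eq[symmetric])
    finally show ?thesis using True by (simp add: g_eigenvalue_def)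
  next
    case False
    then obtain j where "r j \<noteq> s j" by auto
    then have "(\<Prod>j\<in>UNIV. g_mat z $ r j $ s j) = 0"
      by (intro prod_zero) (auto simp: g_mat_def)
    with False show ?thesis by simp
  qed
  then show ?thesis by (simp add: tact_def if_distrib[of "\<lambda>c. c * _"] cong: if_cong)
qed

text \<open>
  The eigenvalue is \<open>z\<close> to the power \<open>k - 2 wt r\<close>, where \<open>k\<close> is the number of tensor
  factors; two such powers agree only for equal exponents, as \<open>z\<close> is not a root of unity.
\<close>

lemma g_eigenvalue_eq_iff:
  fixes r s :: "'k::finite tuple"
  assumes z: "\<forall>n>0. z ^ n \<noteq> (1::complex)" "z \<noteq> 0"
  shows "g_eigenvalue z r = g_eigenvalue z s \<longleftrightarrow> wt r = wt s"
proof -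
  have *: "g_eigenvalue z r \<noteq> g_eigenvalue z s" if less: "wt r < wt s" for r s :: "'k tuple"
  proof
    assume "g_eigenvalue z r = g_eigenvalue z s"
    then have "z ^ wt (- r) * z ^ wt s = z ^ wt (- s) * z ^ wt r"
      using z(2) by (simp add: g_eigenvalue_def field_simps)
    moreover have "wt (- r) + wt s = 2 * (wt s - wt r) + (wt (- s) + wt r)"
      using less wt_add_uminus[of r] wt_add_uminus[of s] by simp
    ultimately have "z ^ (2 * (wt s - wt r)) * z ^ (wt (- s) + wt r) = z ^ (wt (- s) + wt r)"
      by (metis power_add)
    then have "z ^ (2 * (wt s - wt r)) = 1" using z(2) by simp
    with z(1) less show False by simp
  qed
  show ?thesis
    using *[of r s] *[of s r] by (cases "wt r" "wt s" rule: linorder_cases)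
      (auto simp: g_eigenvalue_def wt_uminus)
qed

lemma tact_h_component: "tact h_mat x $ r = \<i> ^ CARD('k) * x $ (- r)" for x :: "'k::finite tensor"
proof -
  have "(\<Prod>j\<in>UNIV. h_mat $ r j $ s j) = (if s = - r then \<i> ^ CARD('k) else 0)" for s :: "'k tuple"
  proof (cases "s = - r")
    case False
    then obtain j where "r j = s j" by (auto simp: fun_eq_iff)
    then have "(\<Prod>j\<in>UNIV. h_mat $ r j $ s j) = 0"
      by (intro prod_zero) (auto simp: h_mat_def)
    with False show ?thesis by simp
  qed (simp add: h_mat_def)
  then show ?thesis by (simp add: tact_def if_distrib[of "\<lambda>c. c * _"] cong: if_cong)
qed

lemma linear_op_commute_iff:
  assumes "linear_op X" "linear_op T"
  shows "X \<circ> T = T \<circ> X \<longleftrightarrow> (\<forall>r s. X (T (tvec s)) $ r = T (X (tvec s)) $ r)"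
proof
  assume "X \<circ> T = T \<circ> X"
  then have "X (T x) = T (X x)" for x by (metis comp_apply)
  then show "\<forall>r s. X (T (tvec s)) $ r = T (X (tvec s)) $ r" by simp
next
  assume "\<forall>r s. X (T (tvec s)) $ r = T (X (tvec s)) $ r"
  then show "X \<circ> T = T \<circ> X" using assms by (intro linear_op_eqI linear_op_comp) auto
qed

lemma commutes_with_g_iff:
  fixes X :: "'k::finite operator"
  assumes z: "\<forall>n>0. z ^ n \<noteq> (1::complex)" "z \<noteq> 0" and X: "linear_op X"
  shows "X \<circ> tact (g_mat z) = tact (g_mat z) \<circ> X \<longleftrightarrow>
    (\<forall>r s. wt r \<noteq> wt s \<longrightarrow> X (tvec s) $ r = 0)"
proof -
  have v: "tact (g_mat z) (tvec s) = g_eigenvalue z s *s tvec s" for s :: "'k tuple"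
    by (simp add: vec_eq_iff tact_g_component tvec_component)
  have "X \<circ> tact (g_mat z) = tact (g_mat z) \<circ> X \<longleftrightarrow>
      (\<forall>r s. X (tact (g_mat z) (tvec s)) $ r = tact (g_mat z) (X (tvec s)) $ r)"
    by (rule linear_op_commute_iff[OF X linear_tact])
  also have "\<dots> \<longleftrightarrow> (\<forall>r s. (g_eigenvalue z s - g_eigenvalue z r) * X (tvec s) $ r = 0)"
    by (simp add: v linear_op_scale[OF X] tact_g_component algebra_simps)
  also have "\<dots> \<longleftrightarrow> (\<forall>r s. wt r \<noteq> wt s \<longrightarrow> X (tvec s) $ r = 0)"
    unfolding mult_eq_0_iff right_minus_eq g_eigenvalue_eq_iff[OF z] by metis
  finally show ?thesis .
qed

lemma commutes_with_h_iff:
  fixes X :: "'k::finite operator"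
  assumes X: "linear_op X"
  shows "X \<circ> tact h_mat = tact h_mat \<circ> X \<longleftrightarrow> (\<forall>r s. X (tvec (- s)) $ (- r) = X (tvec s) $ r)"
proof -
  have v: "tact h_mat (tvec s) = \<i> ^ CARD('k) *s tvec (- s)" for s :: "'k tuple"
    by (auto simp: vec_eq_iff tact_h_component tvec_component)
  have "X \<circ> tact h_mat = tact h_mat \<circ> X \<longleftrightarrow>
      (\<forall>r s. X (tact h_mat (tvec s)) $ r = tact h_mat (X (tvec s)) $ r)"
    by (rule linear_op_commute_iff[OF X linear_tact])
  also have "\<dots> \<longleftrightarrow> (\<forall>r s. X (tvec (- s)) $ r = X (tvec s) $ (- r))"
    by (simp add: v linear_op_scale[OF X] tact_h_component)
  also have "\<dots> \<longleftrightarrow> (\<forall>r s. X (tvec (- s)) $ (- r) = X (tvec s) $ r)"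
  proof (intro iffI allI)
    fix r s
    assume "\<forall>r s. X (tvec (- s)) $ r = X (tvec s) $ (- r)"
    then have "X (tvec (- s)) $ (- r) = X (tvec s) $ (- (- r))" by blast
    then show "X (tvec (- s)) $ (- r) = X (tvec s) $ r" by simp
  next
    fix r s
    assume "\<forall>r s. X (tvec (- s)) $ (- r) = X (tvec s) $ r"
    then have "X (tvec (- s)) $ (- (- r)) = X (tvec s) $ (- r)" by blast
    then show "X (tvec (- s)) $ r = X (tvec s) $ (- r)" by simp
  qed
  finally show ?thesis .
qed

text \<open>
  For \<open>z\<close> of absolute value 1 and not a root of unity, the next two sets are the centralizer
  algebras of \<open>C_inf z\<close> and \<open>D_inf z\<close>, written as conditions on matrix entries: the entry of \<open>X\<close> in row \<open>r\<close> and column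
  \<open>s\<close> is \<open>X (tvec s) $ r\<close>.
\<close>

definition weight_ops :: "'k::finite operator set" where
  "weight_ops = {X. linear_op X \<and> (\<forall>r s. wt r \<noteq> wt s \<longrightarrow> X (tvec s) $ r = 0)}"

definition symmetric_weight_ops :: "'k::finite operator set" where
  "symmetric_weight_ops = {X \<in> weight_ops. \<forall>r s. X (tvec (- s)) $ (- r) = X (tvec s) $ r}"

lemma centralizer_C_inf:
  assumes z: "\<forall>n>0. z ^ n \<noteq> 1" "cmod z = 1"
  shows "centralizer (C_inf z) = (weight_ops :: 'k::finite operator set)"
proof -
  have "z \<noteq> 0" using z(2) by auto
  moreover have "centralizer (C_inf z) = (centralizer {g_mat z} :: 'k operator set)"
    unfolding C_inf_def using generators_in_SU2[OF z(2)] by (intro centralizer_generate) auto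
  ultimately show ?thesis
    using commutes_with_g_iff[OF z(1)] by (auto simp: weight_ops_def centralizer_def)
qed

lemma centralizer_D_inf:
  assumes z: "\<forall>n>0. z ^ n \<noteq> 1" "cmod z = 1"
  shows "centralizer (D_inf z) = (symmetric_weight_ops :: 'k::finite operator set)"
proof -
  have "z \<noteq> 0" using z(2) by auto
  moreover have "centralizer (D_inf z) = (centralizer {g_mat z, h_mat} :: 'k operator set)"
    unfolding D_inf_def using generators_in_SU2[OF z(2)] by (intro centralizer_generate) auto
  moreover have "X \<in> centralizer {g_mat z, h_mat} \<longleftrightarrow> X \<in> symmetric_weight_ops"
    for X :: "'k operator"
  proof (cases "linear_op X")
    case True
    then show ?thesis
      using commutes_with_g_iff[OF z(1) \<open>z \<noteq> 0\<close> True] commutes_with_h_iff[OF True]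
      by (simp add: symmetric_weight_ops_def weight_ops_def centralizer_def)
  qed (simp add: symmetric_weight_ops_def weight_ops_def centralizer_def)
  ultimately show ?thesis by blast
qed

section \<open>Order and counting of sign tuples\<close>

lemma less_fun_uminus_cases:
  "less_fun (- r) r \<or> less_fun r (- r)" for r :: "'k::{finite,linorder} tuple"
proof -
  have "finite {j. (- r) j \<noteq> r j}" by simp
  then show ?thesis using less_fun_trichotomy[of "- r" r] uminus_tuple_ne[of r] by blast
qed

lemma gt_uminus_iff:
  "r \<succ> - r \<longleftrightarrow> wt r < wt (- r) \<or> wt r = wt (- r) \<and> less_fun (- r) r"
  for r :: "'k::{finite,linorder} tuple"
  by (auto simp: tuple_gt_def tuple_ge_def uminus_tuple_ne)

text \<open>
  A tuple never equals its negative and the order is total, so exactly one member of each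
  pair \<open>r\<close>, \<open>- r\<close> satisfies \<open>r \<succ> - r\<close>.  The positive members thus represent the
  orbits of negation.
\<close>

lemma uminus_gt_iff: "- r \<succ> r \<longleftrightarrow> \<not> r \<succ> - r"
  for r :: "'k::{finite,linorder} tuple"
  using gt_uminus_iff[of r] gt_uminus_iff[of "- r"] less_fun_uminus_cases[of r]
    less_fun_asym[of r "- r"] by auto

lemma wt_uminus_eq_iff: "wt (- r) = wt (- s) \<longleftrightarrow> wt r = wt s" for r s :: "'k::finite tuple"
  using wt_add_uminus[of r] wt_add_uminus[of s] by linarith

lemma card_wt: "card {r :: 'k::finite tuple. wt r = b} = CARD('k) choose b"
proof -
  have "bij_betw (\<lambda>r. {j. r j = False}) {r :: 'k tuple. wt r = b} {R. R \<subseteq> UNIV \<and> card R = b}"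
  proof (rule bij_betwI[where g = tuple_of_set])
    show "(\<lambda>r. {j. r j = False}) \<in> {r :: 'k tuple. wt r = b} \<rightarrow> {R. R \<subseteq> UNIV \<and> card R = b}"
      by (auto simp: wt_def)
    show "tuple_of_set \<in> {R. R \<subseteq> UNIV \<and> card R = b} \<rightarrow> {r :: 'k tuple. wt r = b}"
      by (auto simp: wt_def tuple_of_set_def)
  qed (auto simp: tuple_of_set_def fun_eq_iff)
  then have "card {r :: 'k tuple. wt r = b} = card {R. R \<subseteq> (UNIV :: 'k set) \<and> card R = b}"
    by (rule bij_betw_same_card)
  then show ?thesis by (simp only: n_subsets[OF finite])
qed

text \<open>
  Sorting the pairs by their common weight gives a sum of squares of binomial coefficients,
  which is Vandermonde's convolution.
\<close>

lemma card_equal_wt_pairs: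
  "card {(r :: 'k::finite tuple, s :: 'k tuple). wt r = wt s} = (2 * CARD('k)) choose CARD('k)"
proof -
  let ?L = "\<lambda>b. {r :: 'k tuple. wt r = b}"
  have eq: "{(r :: 'k tuple, s :: 'k tuple). wt r = wt s} = (\<Union>b\<in>{..CARD('k)}. ?L b \<times> ?L b)"
    using wt_le by auto
  have "card {(r :: 'k tuple, s :: 'k tuple). wt r = wt s} = (\<Sum>b\<le>CARD('k). card (?L b \<times> ?L b))"
    unfolding eq by (rule card_UN_disjoint) auto
  also have "\<dots> = (\<Sum>b\<le>CARD('k). (CARD('k) choose b)^2)"
    by (simp add: card_cartesian_product card_wt power2_eq_square)
  finally show ?thesis by (simp add: choose_square_sum)
qed

lemma card_involution_half:
  assumes "finite J" and n: "\<And>x. x \<in> J \<Longrightarrow> n x \<in> J" "\<And>x. x \<in> J \<Longrightarrow> n (n x) = x"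
    and P: "\<And>x. x \<in> J \<Longrightarrow> P (n x) \<longleftrightarrow> \<not> P x"
  shows "card J = 2 * card {x \<in> J. P x}"
proof -
  have "bij_betw n {x \<in> J. P x} {x \<in> J. \<not> P x}"
    by (rule bij_betwI[where g = n]) (simp_all add: n P)
  then have "card {x \<in> J. \<not> P x} = card {x \<in> J. P x}" by (simp add: bij_betw_same_card)
  moreover have "card J = card ({x \<in> J. P x} \<union> {x \<in> J. \<not> P x})"
    by (rule arg_cong[where f = card]) blast
  moreover have "\<dots> = card {x \<in> J. P x} + card {x \<in> J. \<not> P x}"
    using \<open>finite J\<close> by (intro card_Un_disjoint) auto
  ultimately show ?thesis by simp
qed

lemma central_binomial_half: "0 < k \<Longrightarrow> (2 * k) choose k = 2 * ((2 * k - 1) choose k)"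
proof -
  assume "0 < k"
  then obtain m where k: "k = Suc m" by (cases k) auto
  have "(2 * k) choose k = (2 * m + 1 choose m) + (2 * m + 1 choose Suc m)"
    by (simp add: k)
  also have "2 * m + 1 choose m = (2 * m + 1 choose Suc m)"
    using binomial_symmetric[of m "2 * m + 1"] by (simp add: Suc_diff_le)
  finally show ?thesis by (simp add: k)
qed

section \<open>Bases and dimensions of the centralizers\<close>

lemma E_unit_component: "E_unit r s (tvec t) $ p = (if s = t \<and> p = r then 1 else 0)"
  by (simp add: E_unit_def tvec_component)

lemma e_unit_component:
  "e_unit r s (tvec t) $ p = (if s = t \<and> p = r then 1 else 0) + (if - s = t \<and> p = - r then 1 else 0)"
  by (simp add: e_unit_def plus_fun_def E_unit_component)

lemma linear_op_plus: "linear_op X \<Longrightarrow> linear_op Y \<Longrightarrow> linear_op (X + Y)"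
  by (simp add: linear_op_iff plus_fun_def vec.scale_right_distrib)

lemma linear_op_op_scale: "linear_op X \<Longrightarrow> linear_op (op_scale c X)"
  by (simp add: linear_op_iff op_scale_def vec.scale_right_distrib mult.commute)

lemma linear_op_zero: "linear_op 0"
  by (simp add: linear_op_iff zero_fun_def)

lemma subspace_weight_ops: "opr.subspace weight_ops"
  by (rule opr.subspaceI)
    (auto simp: weight_ops_def linear_op_plus linear_op_op_scale linear_op_zero,
     auto simp: plus_fun_def zero_fun_def op_scale_def)

lemma subspace_symmetric_weight_ops: "opr.subspace symmetric_weight_ops"
proof (rule opr.subspaceI)
  show "0 \<in> symmetric_weight_ops"
    using opr.subspace_0[OF subspace_weight_ops]
    by (simp add: symmetric_weight_ops_def zero_fun_def)
next
  fix X Y :: "'k::finite operator" assume "X \<in> symmetric_weight_ops" "Y \<in> symmetric_weight_ops"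
  then show "X + Y \<in> symmetric_weight_ops"
    using opr.subspace_add[OF subspace_weight_ops, of X Y]
    by (simp add: symmetric_weight_ops_def plus_fun_def)
next
  fix X :: "'k::finite operator" and c assume "X \<in> symmetric_weight_ops"
  then show "op_scale c X \<in> symmetric_weight_ops"
    using opr.subspace_scale[OF subspace_weight_ops, of X c]
    by (simp add: symmetric_weight_ops_def op_scale_def)
qed

lemma E_unit_mem: "wt r = wt s \<Longrightarrow> E_unit r s \<in> weight_ops"
  by (auto simp: weight_ops_def linear_E_unit E_unit_component)

lemma e_unit_mem:
  assumes "wt r = wt s"
  shows "e_unit r s \<in> symmetric_weight_ops"
proof -
  have "e_unit r s \<in> weight_ops"
    unfolding e_unit_def
    by (intro opr.subspace_add[OF subspace_weight_ops] E_unit_mem) (simp_all add: assms wt_uminus_eq_iff)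
  then show ?thesis
    by (auto simp: symmetric_weight_ops_def e_unit_component)
qed

lemma operator_eq_0I:
  assumes "linear_op X" "\<And>r s. X (tvec s) $ r = 0"
  shows "X = 0"
  by (rule linear_op_eqI[OF assms(1) linear_op_zero]) (simp add: assms(2) zero_fun_def)

lemma dim_weight_ops:
  "opr.dim (weight_ops :: 'k::finite operator set) = (2 * CARD('k)) choose CARD('k)"
proof -
  have "opr.dim (weight_ops :: 'k operator set) = card {(r :: 'k tuple, s :: 'k tuple). wt r = wt s}"
  proof (rule opr.dual_family_basis(3)[where b = "\<lambda>(r :: 'k tuple, s :: 'k tuple). E_unit r s"
        and f = "\<lambda>(r :: 'k tuple, s :: 'k tuple) X. X (tvec s) $ r"])
    fix X :: "'k operator"
    assume "X \<in> weight_ops"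
      "\<forall>i\<in>{(r :: 'k tuple, s :: 'k tuple). wt r = wt s}. (case i of (r, s) \<Rightarrow> \<lambda>X. X (tvec s) $ r) X = 0"
    then show "X = 0" by (intro operator_eq_0I) (auto simp: weight_ops_def)
  qed (auto simp: plus_fun_def op_scale_def E_unit_component E_unit_mem subspace_weight_ops
      split: if_splits)
  then show ?thesis by (simp add: card_equal_wt_pairs)
qed

text \<open>
  Negation permutes the admissible index pairs without fixed points, and a symmetric operator
  has equal entries along each orbit.  The entries at the positive representatives are
  therefore dual to the operators \<open>e_unit r s\<close> and determine the operator.
\<close>

lemma symmetric_weight_ops_basis:
  defines "I \<equiv> {(r :: 'k::{finite,linorder} tuple, s :: 'k tuple). r \<succ> - r \<and> wt r = wt s}"
  shows "opr.independent ((\<lambda>(r, s). e_unit r s) ` I)"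
    and "opr.span ((\<lambda>(r, s). e_unit r s) ` I) = symmetric_weight_ops"
    and "opr.dim (symmetric_weight_ops :: 'k operator set) = card I"
proof -
  let ?b = "\<lambda>(r :: 'k tuple, s :: 'k tuple). e_unit r s"
    and ?f = "\<lambda>(r :: 'k tuple, s :: 'k tuple) X. X (tvec s) $ r :: complex"
  have dual: "?f i (?b j) = (if i = j then 1 else 0)" if ij: "i \<in> I" "j \<in> I" for i j
  proof -
    obtain r s p q where "i = (r, s)" "j = (p, q)" by fastforce
    moreover from this ij have "r \<noteq> - p" using uminus_gt_iff[of p] by (auto simp: I_def)
    ultimately show ?thesis by (auto simp: e_unit_component)
  qed
  have sep: "X = 0" if X: "X \<in> symmetric_weight_ops" and 0: "\<forall>i\<in>I. ?f i X = 0" for X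
  proof (rule operator_eq_0I)
    show "linear_op X" using X by (simp add: symmetric_weight_ops_def weight_ops_def)
    fix r s :: "'k tuple"
    consider "wt r \<noteq> wt s" | "(r, s) \<in> I" | "(- r, - s) \<in> I"
      using uminus_gt_iff[of r] wt_uminus_eq_iff[of r s] by (auto simp: I_def)
    then show "X (tvec s) $ r = 0"
    proof cases
      case 1
      then show ?thesis using X by (simp add: symmetric_weight_ops_def weight_ops_def)
    next
      case 2
      then show ?thesis using 0 by auto
    next
      case 3
      then have "X (tvec (- s)) $ (- r) = 0" using 0 by fastforce
      then show ?thesis using X by (simp add: symmetric_weight_ops_def)
    qed
  qed
  have mem: "?b i \<in> symmetric_weight_ops" if "i \<in> I" for i
    using that e_unit_mem by (auto simp: I_def)
  have add: "?f i (X + Y) = ?f i X + ?f i Y" and hom: "?f i (op_scale c X) = c * ?f i X" for i X Y c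
    by (auto simp: plus_fun_def op_scale_def split: prod.split)
  note basis = opr.dual_family_basis[where b = ?b and f = ?f,
      OF finite add hom dual subspace_symmetric_weight_ops mem sep]
  show "opr.independent (?b ` I)" by (rule basis(1)) assumption+
  show "opr.span (?b ` I) = symmetric_weight_ops" by (rule basis(2)) assumption+
  show "opr.dim (symmetric_weight_ops :: 'k operator set) = card I" by (rule basis(3)) assumption+
qed

lemma dim_symmetric_weight_ops:
  "2 * opr.dim (symmetric_weight_ops :: 'k::{finite,linorder} operator set)
    = (2 * CARD('k)) choose CARD('k)"
proof -
  let ?J = "{(r :: 'k tuple, s :: 'k tuple). wt r = wt s}"
  have "card ?J = 2 * card {x \<in> ?J. fst x \<succ> - fst x}"
    by (rule card_involution_half[where n = "\<lambda>(r, s). (- r, - s)"])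
      (simp_all add: split_beta wt_uminus_eq_iff uminus_gt_iff)
  also have "{x \<in> ?J. fst x \<succ> - fst x} = {(r, s). r \<succ> - r \<and> wt r = wt s}" by auto
  finally show ?thesis by (simp add: symmetric_weight_ops_basis(3) card_equal_wt_pairs)
qed

section \<open>Irreducible modules\<close>

lemma K_set_iff: "r \<in> K_set l \<longleftrightarrow> wt (- r) = wt r + l" for r :: "'k::finite tuple"
  using wt_add_uminus[of r] by (auto simp: K_set_def)

lemma K_set_eq_wt:
  assumes "l \<le> CARD('k)" "even (CARD('k) - l)"
  shows "(K_set l :: 'k::finite tuple set) = {r. wt r = (CARD('k) - l) div 2}"
proof -
  obtain m where "CARD('k) - l = 2 * m" using assms(2) by (elim evenE)
  then have *: "wt (- r) = wt r + l \<longleftrightarrow> wt r = (CARD('k) - l) div 2" for r :: "'k tuple"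
    using wt_add_uminus[of r] assms(1) by auto
  show ?thesis by (rule Set.set_eqI) (simp only: K_set_iff mem_Collect_eq *)
qed

lemma card_K_set:
  assumes "l \<le> CARD('k)" "even (CARD('k) - l)"
  shows "card (K_set l :: 'k::finite tuple set) = CARD('k) choose ((CARD('k) - l) div 2)"
  by (simp add: K_set_eq_wt[OF assms] card_wt)

lemma symmetric_weight_opsD:
  assumes "X \<in> symmetric_weight_ops"
  shows "linear_op X" and "wt r \<noteq> wt s \<Longrightarrow> X (tvec s) $ r = 0"
    and "X (tvec (- s)) $ (- r) = X (tvec s) $ r"
  using assms by (auto simp: symmetric_weight_ops_def weight_ops_def)

lemma weight_expansion:
  assumes "X \<in> symmetric_weight_ops"
  shows "X (tvec s) = (\<Sum>r | wt r = wt s. X (tvec s) $ r *s tvec r)"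
proof -
  have "X (tvec s) = (\<Sum>r\<in>UNIV. X (tvec s) $ r *s tvec r)" by (rule tensor_expansion)
  also have "\<dots> = (\<Sum>r | wt r = wt s. X (tvec s) $ r *s tvec r)"
    using symmetric_weight_opsD(2)[OF assms, of _ s] by (intro sum.mono_neutral_right) auto
  finally show ?thesis .
qed

lemma e_unit_tvec:
  "t \<noteq> - s \<Longrightarrow> e_unit r s (tvec t) = (if s = t then tvec r else 0)"
  by (auto simp: e_unit_def plus_fun_def E_unit_tvec)

text \<open>
  Here \<open>K_set l\<close> is a single weight class, so its span is invariant.  Because \<open>l\<close> is positive,
  the class is disjoint from its negative, and the operators \<open>e_unit r s\<close> with indices in it
  act as matrix units.
\<close>

lemma irreducible_K_set:
  assumes l: "1 \<le> l" "l \<le> CARD('k)" "even (CARD('k) - l)"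
  shows "irreducible_module symmetric_weight_ops (vec.span (tvec ` (K_set l :: 'k::finite tuple set)))"
    and "vec.dim (vec.span (tvec ` (K_set l :: 'k tuple set))) = CARD('k) choose ((CARD('k) - l) div 2)"
proof -
  let ?K = "K_set l :: 'k tuple set" and ?A = "symmetric_weight_ops :: 'k operator set"
  have "card ?K > 0" using card_K_set[OF l(2,3)] by simp
  then have ne: "?K \<noteq> {}" by auto
  have inv: "X (tvec s) \<in> vec.span (tvec ` ?K)" if X: "X \<in> ?A" and s: "s \<in> ?K" for X s
  proof -
    have "{r. wt r = wt s} = ?K" using s by (simp add: K_set_eq_wt[OF l(2,3)])
    then show ?thesis
      by (subst weight_expansion[OF X]) (intro vec.span_sum vec.span_scale, simp add: vec.span_base)
  qed
  have nz: "tvec s \<noteq> 0" if "s \<in> ?K" for s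
    using tvec_component[of s s] by (metis zero_index zero_neq_one)
  have F: "e_unit r s \<in> ?A" if "r \<in> ?K" "s \<in> ?K" for r s
    using that by (intro e_unit_mem) (simp add: K_set_eq_wt[OF l(2,3)])
  have Fu: "e_unit r s (tvec t) = (if s = t then tvec r else 0)" if "r \<in> ?K" "s \<in> ?K" "t \<in> ?K" for r s t
    using that l(1) by (intro e_unit_tvec) (auto simp: K_set_iff)
  note irr = matrix_units_irreducible[where u = tvec and F = e_unit and A = ?A, OF finite ne]
  show "irreducible_module ?A (vec.span (tvec ` ?K))"
    by (rule irr(1)) (fact symmetric_weight_opsD(1) inv nz F Fu)+
  have "vec.dim (vec.span (tvec ` ?K)) = card ?K"
    by (rule irr(2)) (fact symmetric_weight_opsD(1) inv nz F Fu)+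
  then show "vec.dim (vec.span (tvec ` ?K)) = CARD('k) choose ((CARD('k) - l) div 2)"
    by (simp add: card_K_set[OF l(2,3)])
qed

lemma w_vec_component:
  fixes t p :: "'k::finite tuple"
  shows "w_vec \<sigma> t $ p = (if p = t then 1 else 0) + (if p = - t then \<sigma> * i_inv_pow CARD('k) else 0)"
  by (simp add: w_vec_def tvec_component)

lemma w_vec_nonzero: "w_vec \<sigma> t \<noteq> 0"
proof
  assume "w_vec \<sigma> t = 0"
  then have "w_vec \<sigma> t $ t = 0" by simp
  then show False by (simp add: w_vec_component uminus_tuple_ne)
qed

text \<open>
  Each \<open>e_pm \<sigma> r s\<close> has rank one: it is \<open>w_vec \<sigma> r\<close> times a functional.  The functional
  takes the value 1 on \<open>w_vec \<sigma> s\<close> and annihilates every \<open>w_vec (- \<sigma>) t\<close>.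
\<close>

lemma e_pm_apply:
  fixes r s :: "'k::finite tuple"
  assumes "even CARD('k)" "\<sigma> \<in> {1, - 1}"
  shows "e_pm \<sigma> r s x = ((x $ s + \<sigma> * i_inv_pow CARD('k) * x $ (- s)) / 2) *s w_vec \<sigma> r"
proof -
  let ?c = "\<sigma> * i_inv_pow CARD('k)"
  have "?c * ?c = 1"
    using i_inv_pow_even[OF assms(1)] assms(2) by auto
  then have "?c * (?c * y) = y" for y by (metis mult.assoc mult_1)
  then show ?thesis
    by (simp add: e_pm_def w_vec_def op_scale_def plus_fun_def E_unit_def vec_eq_iff algebra_simps
        add_divide_distrib)
qed

lemma e_pm_w_vec:
  fixes r s t :: "'k::finite tuple"
  assumes "even CARD('k)" "\<sigma> \<in> {1, - 1}"
  shows "t \<noteq> - s \<Longrightarrow> e_pm \<sigma> r s (w_vec \<sigma> t) = (if s = t then w_vec \<sigma> r else 0)"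
    and "e_pm \<sigma> r s (w_vec (- \<sigma>) t) = 0"
proof -
  let ?c = "\<sigma> * i_inv_pow CARD('k)"
  have c: "?c * ?c = 1"
    using i_inv_pow_even[OF assms(1)] assms(2) by auto
  have st: "s = - t \<longleftrightarrow> t = - s" "- s = - t \<longleftrightarrow> s = t" "- s = t \<longleftrightarrow> t = - s" by auto
  show "e_pm \<sigma> r s (w_vec \<sigma> t) = (if s = t then w_vec \<sigma> r else 0)" if "t \<noteq> - s"
    using that c by (simp add: e_pm_apply[OF assms] w_vec_component st)
  show "e_pm \<sigma> r s (w_vec (- \<sigma>) t) = 0"
    using c by (auto simp: e_pm_apply[OF assms] w_vec_component st uminus_tuple_ne)
qed

lemma e_pm_mem:
  fixes r s :: "'k::finite tuple"
  assumes "wt r = wt s" "wt s = wt (- s)"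
  shows "e_pm \<sigma> r s \<in> symmetric_weight_ops"
proof -
  have "e_pm \<sigma> r s = op_scale (1/2) (e_unit r s + op_scale (\<sigma> * i_inv_pow CARD('k)) (e_unit r (- s)))"
    by (simp add: e_pm_def e_unit_def)
  moreover have "e_unit r s \<in> symmetric_weight_ops" "e_unit r (- s) \<in> symmetric_weight_ops"
    using assms by (auto intro!: e_unit_mem)
  ultimately show ?thesis
    by (simp only: opr.subspace_scale opr.subspace_add subspace_symmetric_weight_ops)
qed

text \<open>
  For an eigenvector of negation supported in the middle weight, the coordinates at one
  representative of each pair \<open>t\<close>, \<open>- t\<close> determine the vector.  The set \<open>I\<close> of
  representatives is arbitrary, because the blocks of negative sign below use
  the tuples with \<open>- t \<succ> t\<close>.
\<close>

lemma eigenvector_expansion: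
  fixes y :: "'k::finite tensor"
  assumes supp: "\<And>p. wt p \<noteq> wt (- p) \<Longrightarrow> y $ p = 0"
    and eigen: "\<And>p. y $ (- p) = \<sigma> * i_inv_pow CARD('k) * y $ p"
    and I: "\<And>t. wt t = wt (- t) \<Longrightarrow> t \<in> I \<longleftrightarrow> - t \<notin> I"
  shows "y = (\<Sum>t\<in>I. y $ t *s w_vec \<sigma> t)"
proof -
  let ?c = "\<sigma> * i_inv_pow CARD('k)"
  have "y $ p = (\<Sum>t\<in>I. y $ t *s w_vec \<sigma> t) $ p" for p
  proof -
    have "y $ t * w_vec \<sigma> t $ p = (if p = t then y $ t else 0) + (if - p = t then y $ t * ?c else 0)" for t
      by (auto simp: w_vec_component uminus_tuple_ne)
    then have "(\<Sum>t\<in>I. y $ t *s w_vec \<sigma> t) $ p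
        = (\<Sum>t\<in>I. if p = t then y $ t else 0) + (\<Sum>t\<in>I. if - p = t then y $ t * ?c else 0)"
      by (simp only: sum_component vector_smult_component sum.distrib)
    also have "\<dots> = (if p \<in> I then y $ p else 0) + (if - p \<in> I then ?c * y $ (- p) else 0)"
      by (simp add: mult.commute)
    also have "?c * y $ (- p) = y $ p" using eigen[of "- p"] by simp
    also have "(if p \<in> I then y $ p else 0) + (if - p \<in> I then y $ p else 0) = y $ p"
    proof (cases "wt p = wt (- p)")
      case True
      then show ?thesis using I[OF True] by simp
    next
      case False
      then show ?thesis using supp[OF False] by simp
    qed
    finally show ?thesis ..
  qed
  then show ?thesis unfolding vec_eq_iff by blast
qed

text \<open>
  The vector \<open>w_vec \<sigma> s\<close> is an eigenvector of negation, and its image is another one for the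
  same eigenvalue, since a symmetric operator commutes with negation.
\<close>

lemma w_vec_image_expansion:
  fixes X :: "'k::finite operator"
  assumes X: "X \<in> symmetric_weight_ops" and s: "wt s = wt (- s)" and \<sigma>: "\<sigma> \<in> {1, - 1}"
    and I: "\<And>t. wt t = wt (- t) \<Longrightarrow> t \<in> I \<longleftrightarrow> - t \<notin> I"
  shows "X (w_vec \<sigma> s) = (\<Sum>t\<in>I. X (w_vec \<sigma> s) $ t *s w_vec \<sigma> t)"
proof (rule eigenvector_expansion)
  let ?c = "\<sigma> * i_inv_pow CARD('k)"
  have "even CARD('k)" using wt_add_uminus[of s] s by presburger
  then have "?c * ?c = 1" using i_inv_pow_even \<sigma> by fastforce
  then have cc: "?c * (?c * y) = y" for y by (metis mult.assoc mult_1)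
  have y: "X (w_vec \<sigma> s) $ p = X (tvec s) $ p + ?c * X (tvec (- s)) $ p" for p
    by (simp add: w_vec_def linear_op_add[OF symmetric_weight_opsD(1)[OF X]]
        linear_op_scale[OF symmetric_weight_opsD(1)[OF X]])
  show "X (w_vec \<sigma> s) $ p = 0" if "wt p \<noteq> wt (- p)" for p
  proof -
    have "wt p \<noteq> wt s" using that s wt_uminus_eq_iff[of p s] by auto
    then show ?thesis using s by (simp add: y symmetric_weight_opsD(2)[OF X])
  qed
  show "X (w_vec \<sigma> s) $ (- p) = ?c * X (w_vec \<sigma> s) $ p" for p
    using symmetric_weight_opsD(3)[OF X, of s p] symmetric_weight_opsD(3)[OF X, of "- s" p]
    by (simp only: y distrib_left cc boolean_algebra.double_compl) (simp add: add.commute)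
qed (erule I)

text \<open>
  Since \<open>w_vec \<sigma> (- t)\<close> is a multiple of \<open>w_vec \<sigma> t\<close>, the positive half of the middle
  weight class already spans the module, and on this half the operators \<open>e_pm \<sigma> r s\<close> act as
  matrix units.
\<close>

lemma irreducible_K_set_0:
  assumes k: "even CARD('k)" and \<sigma>: "\<sigma> \<in> {1, - 1}"
  shows "irreducible_module symmetric_weight_ops
      (vec.span (w_vec \<sigma> ` (K_set 0 :: 'k::{finite,linorder} tuple set)))"
    and "2 * vec.dim (vec.span (w_vec \<sigma> ` (K_set 0 :: 'k tuple set))) = CARD('k) choose (CARD('k) div 2)"
proof -
  let ?K = "K_set 0 :: 'k tuple set" and ?A = "symmetric_weight_ops :: 'k operator set"
  let ?I = "{t \<in> ?K. t \<succ> - t}"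
  have K: "wt t = wt (- t) \<longleftrightarrow> t \<in> ?K" for t by (auto simp: K_set_iff)
  have Ku: "- t \<in> ?K \<longleftrightarrow> t \<in> ?K" for t by (auto simp: K_set_iff)
  have half: "t \<in> ?I \<longleftrightarrow> - t \<notin> ?I" if "t \<in> ?K" for t
    using that uminus_gt_iff[of t] by (simp add: Ku)
  have span: "vec.span (w_vec \<sigma> ` ?K) = vec.span (w_vec \<sigma> ` ?I)"
  proof (rule antisym)
    have "w_vec \<sigma> t \<in> vec.span (w_vec \<sigma> ` ?I)" if t: "t \<in> ?K" for t
    proof (cases "t \<in> ?I")
      case True
      then show ?thesis by (intro vec.span_base) blast
    next
      case False
      then have "w_vec \<sigma> (- t) \<in> vec.span (w_vec \<sigma> ` ?I)"
        using half[OF t] by (intro vec.span_base) blast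
      then have "(\<sigma> * i_inv_pow CARD('k)) *s w_vec \<sigma> (- t) \<in> vec.span (w_vec \<sigma> ` ?I)"
        by (rule vec.span_scale)
      then show ?thesis using w_vec_uminus[OF k \<sigma>, of "- t"] by simp
    qed
    then show "vec.span (w_vec \<sigma> ` ?K) \<subseteq> vec.span (w_vec \<sigma> ` ?I)"
      by (intro vec.span_minimal) (auto simp: vec.subspace_span)
  qed (rule vec.span_mono, blast)
  have card: "card ?K = 2 * card ?I"
    by (rule card_involution_half[where n = uminus]) (simp_all add: Ku uminus_gt_iff)
  have cardK: "card ?K = CARD('k) choose (CARD('k) div 2)" using card_K_set[of 0] k by simp
  have "card ?K > 0" unfolding cardK by simp
  then have ne: "?I \<noteq> {}" using card by fastforce
  have inv: "X (w_vec \<sigma> s) \<in> vec.span (w_vec \<sigma> ` ?I)" if X: "X \<in> ?A" and s: "s \<in> ?I" for X s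
  proof -
    have "X (w_vec \<sigma> s) = (\<Sum>t\<in>?I. X (w_vec \<sigma> s) $ t *s w_vec \<sigma> t)"
    proof (rule w_vec_image_expansion[OF X _ \<sigma>])
      show "wt s = wt (- s)" using s K by blast
      show "t \<in> ?I \<longleftrightarrow> - t \<notin> ?I" if "wt t = wt (- t)" for t using half that K by blast
    qed
    also have "\<dots> \<in> vec.span (w_vec \<sigma> ` ?I)"
      by (intro vec.span_sum vec.span_scale vec.span_base) blast
    finally show ?thesis .
  qed
  have F: "e_pm \<sigma> r s \<in> ?A" if "r \<in> ?I" "s \<in> ?I" for r s
  proof (rule e_pm_mem)
    show "wt s = wt (- s)" using that K by blast
    show "wt r = wt s" using that k by (simp add: K_set_eq_wt)
  qed
  have Fu: "e_pm \<sigma> r s (w_vec \<sigma> t) = (if s = t then w_vec \<sigma> r else 0)" if "r \<in> ?I" "s \<in> ?I" "t \<in> ?I" for r s t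
    using that half by (intro e_pm_w_vec(1)[OF k \<sigma>]) auto
  have nz: "w_vec \<sigma> s \<noteq> 0" if "s \<in> ?I" for s by (rule w_vec_nonzero)
  note irr = matrix_units_irreducible[where u = "w_vec \<sigma>" and F = "e_pm \<sigma>" and A = ?A, OF finite ne]
  show "irreducible_module ?A (vec.span (w_vec \<sigma> ` ?K))"
    unfolding span by (rule irr(1)) (fact symmetric_weight_opsD(1) inv nz F Fu)+
  have "vec.dim (vec.span (w_vec \<sigma> ` ?I)) = card ?I"
    by (rule irr(2)) (fact symmetric_weight_opsD(1) inv nz F Fu)+
  then show "2 * vec.dim (vec.span (w_vec \<sigma> ` ?K)) = CARD('k) choose (CARD('k) div 2)"
    unfolding span using card cardK by simp
qed

section \<open>The isomorphism with a subalgebra of the planar rook algebra\<close>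

text \<open>
  The three kinds of irreducible modules are treated at once by a parameter with values 0, 1
  and -1.  With parameter 0, the vector \<open>w_vec 0 t\<close> is just \<open>tvec t\<close>, which is what tuples
  below the middle weight require.  In the middle weight, a positive tuple labels a vector of
  the module of sign 1, and its negative labels a vector of the module of sign -1; in this way
  \<open>X R S\<close> and \<open>X (- R) (- S)\<close> become matrix units of two different blocks.
\<close>

definition block_sign :: "'k::{finite,linorder} tuple \<Rightarrow> complex" where
  "block_sign r = (if wt r = wt (- r) then if r \<succ> - r then 1 else - 1 else 0)"

text \<open>
  Tuples above the middle weight lie in no block, not even one with themselves: the modules that
  they would give are isomorphic, via \<open>h\<close>, to those of their negatives.
\<close>

definition same_block :: "'k::{finite,linorder} tuple \<Rightarrow> 'k tuple \<Rightarrow> bool" where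
  "same_block r s \<longleftrightarrow> wt r = wt s \<and> wt r \<le> wt (- r) \<and> block_sign r = block_sign s"

definition block_vec :: "'k::{finite,linorder} tuple \<Rightarrow> 'k tensor" where
  "block_vec r = w_vec (block_sign r) r"

text \<open>
  For the parameter 0 the operator \<open>e_pm 0 r s\<close> would be half of \<open>e_unit r s\<close>, which accounts for
  the case distinction.
\<close>

definition block_unit :: "'k::{finite,linorder} tuple \<Rightarrow> 'k tuple \<Rightarrow> 'k operator" where
  "block_unit r s = (if block_sign r = 0 then e_unit r s else e_pm (block_sign r) r s)"

lemma even_of_wt_eq: "wt r = wt (- r) \<Longrightarrow> even CARD('k)" for r :: "'k::finite tuple"
  using wt_add_uminus[of r] by presburger

lemma block_sign_uminus: "block_sign (- r) = - block_sign r"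
  by (auto simp: block_sign_def uminus_gt_iff)

lemma block_sign_cases:
  "wt r \<noteq> wt (- r) \<and> block_sign r = 0 \<or> wt r = wt (- r) \<and> block_sign r \<in> {1, - 1}"
  by (simp add: block_sign_def)

lemma block_sign_0_iff: "block_sign r = 0 \<longleftrightarrow> wt r \<noteq> wt (- r)"
  using block_sign_cases[of r] by auto

lemma same_block_sym: "same_block r s \<longleftrightarrow> same_block s r"
  using wt_uminus_eq_iff[of r s] by (auto simp: same_block_def)

lemma same_block_trans: "same_block r s \<Longrightarrow> same_block s t \<Longrightarrow> same_block r t"
  by (simp add: same_block_def)

lemma same_block_refl_iff: "same_block r r \<longleftrightarrow> wt r \<le> wt (- r)"
  by (simp add: same_block_def)

lemma same_block_uminus: "same_block (- r) s \<Longrightarrow> \<not> same_block r s"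
  using block_sign_cases[of r]
  by (auto simp: same_block_def block_sign_uminus)

lemma w_vec_0: "w_vec 0 t = tvec t"
  by (simp add: w_vec_def)

lemma block_vec_component:
  assumes "same_block p r"
  shows "block_vec r $ p = (if p = r then 1 else 0)"
proof -
  have "p \<noteq> - r \<or> block_sign r = 0"
    using same_block_uminus[of r r] assms same_block_trans same_block_sym by blast
  then show ?thesis by (auto simp: block_vec_def w_vec_component uminus_tuple_ne)
qed

text \<open>
  The coefficients of \<open>X (block_vec s)\<close> in the basis of its block are plain coordinates,
  because a block never contains a middle tuple together with its negative.
\<close>

lemma block_expansion:
  fixes X :: "'k::{finite,linorder} operator"
  assumes X: "X \<in> symmetric_weight_ops" and s: "wt s \<le> wt (- s)"
  shows "X (block_vec s) = (\<Sum>t | same_block t s. X (block_vec s) $ t *s block_vec t)"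
proof (cases "wt s = wt (- s)")
  case False
  have sign: "block_sign t = 0" if "wt t = wt s" for t :: "'k tuple"
    using False that wt_uminus_eq_iff[of t s] by (simp add: block_sign_def)
  then have I: "{t. same_block t s} = {t. wt t = wt s}"
  proof (intro equalityI subsetI; elim CollectE; intro CollectI)
    fix t :: "'k tuple" assume "wt t = wt s"
    moreover from this have "wt (- t) = wt (- s)" by (simp only: wt_uminus_eq_iff)
    ultimately show "same_block t s" using s sign[of t] sign[of s] by (simp add: same_block_def)
  qed (simp add: same_block_def)
  have "X (tvec s) = (\<Sum>t | wt t = wt s. X (tvec s) $ t *s tvec t)"
    by (rule weight_expansion[OF X])
  also have "\<dots> = (\<Sum>t | wt t = wt s. X (block_vec s) $ t *s block_vec t)"
    by (rule sum.cong) (simp_all add: block_vec_def sign w_vec_0)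
  finally show ?thesis by (simp add: I) (simp add: block_vec_def sign w_vec_0)
next
  case True
  let ?\<sigma> = "block_sign s" and ?I = "{t. same_block t s}"
  have \<sigma>: "?\<sigma> \<in> {1, - 1}" using True block_sign_cases[of s] by simp
  have wt: "wt t = wt (- t) \<longleftrightarrow> wt t = wt s" for t :: "'k tuple"
    using wt_add_uminus[of s] wt_add_uminus[of t] True by linarith
  have I: "t \<in> ?I \<longleftrightarrow> wt t = wt (- t) \<and> block_sign t = ?\<sigma>" for t
    using wt[of t] by (auto simp: same_block_def)
  have half: "t \<in> ?I \<longleftrightarrow> - t \<notin> ?I" if "wt t = wt (- t)" for t
    using that block_sign_cases[of t] \<sigma> unfolding I by (auto simp: block_sign_uminus)
  have "X (w_vec ?\<sigma> s) = (\<Sum>t\<in>?I. X (w_vec ?\<sigma> s) $ t *s w_vec ?\<sigma> t)"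
    by (rule w_vec_image_expansion[OF X True \<sigma> half])
  also have "\<dots> = (\<Sum>t\<in>?I. X (w_vec ?\<sigma> s) $ t *s block_vec t)"
    by (rule sum.cong) (simp_all only: I block_vec_def)
  finally show ?thesis by (simp add: block_vec_def[of s])
qed

lemma e_unit_apply: "e_unit r s x = x $ s *s tvec r + x $ (- s) *s tvec (- r)"
  by (simp add: e_unit_def E_unit_def plus_fun_def)

lemma block_unit_mem:
  assumes "same_block r s"
  shows "block_unit r s \<in> symmetric_weight_ops"
proof (cases "wt r = wt (- r)")
  case True
  moreover from this have "wt s = wt (- s)"
    using assms wt_uminus_eq_iff[of r s] by (simp add: same_block_def)
  ultimately show ?thesis
    using assms e_pm_mem[of r s] by (simp add: block_unit_def block_sign_0_iff same_block_def)
next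
  case False
  then have "block_sign r = 0" by (simp add: block_sign_0_iff)
  then show ?thesis
    using assms e_unit_mem[of r s] by (simp add: block_unit_def same_block_def)
qed

lemma block_unit_block_vec:
  assumes rs: "same_block r s" and t: "wt t \<le> wt (- t)"
  shows "block_unit r s (block_vec t) = (if s = t then block_vec r else 0)"
proof (cases "wt s = wt (- s)")
  case False
  then have lt: "wt s < wt (- s)" and sign: "block_sign r = 0" "block_sign s = 0"
    using rs wt_uminus_eq_iff[of r s] by (auto simp: same_block_def block_sign_0_iff)
  have "s \<noteq> - t"
  proof
    assume "s = - t"
    then show False using lt t by simp
  qed
  moreover from this have "t \<noteq> - s" by auto
  ultimately show ?thesis
    by (cases "s = t")
      (use sign in \<open>auto simp: block_unit_def block_vec_def e_unit_apply w_vec_component w_vec_0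
        tvec_component\<close>)
next
  case True
  let ?\<sigma> = "block_sign s"
  have \<sigma>: "block_sign r = ?\<sigma>" "?\<sigma> \<in> {1, - 1}"
    using True rs block_sign_cases[of s] by (auto simp: same_block_def)
  have k: "even CARD('a)" using even_of_wt_eq[OF True] .
  have unit: "block_unit r s = e_pm ?\<sigma> r s" using \<sigma> by (auto simp: block_unit_def)
  consider "block_sign t = 0" "t \<noteq> s" | "block_sign t = ?\<sigma>" | "block_sign t = - ?\<sigma>"
    using block_sign_cases[of t] \<sigma> by auto
  then show ?thesis
  proof cases
    case 1
    then have "t \<noteq> - s" using \<sigma>(2) by (auto simp: block_sign_uminus)
    then have "tvec t $ s = 0" "tvec t $ (- s) = 0" using 1(2) by (auto simp: tvec_component)
    then show ?thesis using 1 unfolding unit e_pm_apply[OF k \<sigma>(2)] by (simp add: block_vec_def w_vec_0)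
  next
    case 2
    then have "t \<noteq> - s" using \<sigma>(2) by (auto simp: block_sign_uminus)
    from e_pm_w_vec(1)[OF k \<sigma>(2) this] show ?thesis
      by (simp only: unit block_vec_def 2 \<sigma>(1))
  next
    case 3
    then have "t \<noteq> s" using \<sigma>(2) by auto
    then show ?thesis by (simp add: unit block_vec_def 3 e_pm_w_vec(2)[OF k \<sigma>(2)])
  qed
qed

text \<open>
  The vectors \<open>block_vec s\<close> generate the tensor space under negation: below the middle weight
  they are basis vectors, above it symmetry of \<open>X\<close> takes over, and in the middle weight
  \<open>tvec s\<close> is a combination of \<open>block_vec s\<close> and \<open>block_vec (- s)\<close>, which carry
  opposite signs.
\<close>

lemma block_vec_separating:
  fixes X :: "'k::{finite,linorder} operator"
  assumes X: "X \<in> symmetric_weight_ops"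
    and 0: "\<And>s. wt s \<le> wt (- s) \<Longrightarrow> X (block_vec s) = 0"
  shows "X = 0"
proof (rule operator_eq_0I)
  note lin = symmetric_weight_opsD(1)[OF X]
  then show "linear_op X" .
  fix r s :: "'k tuple"
  have low: "X (tvec s) = 0" if "wt s < wt (- s)" for s
    using 0[of s] that by (simp add: block_vec_def block_sign_def w_vec_0)
  consider "wt s < wt (- s)" | "wt (- s) < wt s" | "wt s = wt (- s)" by linarith
  then show "X (tvec s) $ r = 0"
  proof cases
    case 1
    then show ?thesis by (simp add: low)
  next
    case 2
    then have "X (tvec (- s)) $ (- r) = 0" using low[of "- s"] by simp
    then show ?thesis by (simp add: symmetric_weight_opsD(3)[OF X])
  next
    case 3
    let ?c = "block_sign s * i_inv_pow CARD('k)"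
    have "?c * ?c = 1"
      using block_sign_cases[of s] i_inv_pow_even[OF even_of_wt_eq[OF 3]] 3 by auto
    then have "2 *s tvec s = block_vec s + (- ?c) *s block_vec (- s)"
      by (simp add: vec_eq_iff block_vec_def w_vec_def block_sign_uminus algebra_simps)
    then have "2 *s X (tvec s) = X (block_vec s) + (- ?c) *s X (block_vec (- s))"
      by (metis linear_op_add[OF lin] linear_op_scale[OF lin])
    then have "2 *s X (tvec s) = 0" using 0[of s] 0[of "- s"] 3 by simp
    then show ?thesis by (simp add: vec_eq_iff)
  qed
qed

text \<open>
  The isomorphism sends an operator to its matrices on the irreducible modules, written in the
  given matrix units.  It is multiplicative because each module is invariant, injective because
  the modules together separate operators, and surjective because \<open>block_unit r s\<close> is
  sent to \<open>x r s\<close>.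
\<close>

lemma algebra_iso_matrix_units:
  fixes x :: "'k::{finite,linorder} tuple \<Rightarrow> 'k tuple \<Rightarrow> 'k rook_algebra"
  assumes mult: "\<And>r s t u. wt r = wt s \<Longrightarrow> wt t = wt u \<Longrightarrow>
      x r s * x t u = (if s = t then x r u else 0)"
    and nz: "\<And>r s. wt r = wt s \<Longrightarrow> x r s \<noteq> 0"
  shows "algebra_iso (symmetric_weight_ops :: 'k operator set) (rook.span {x r s | r s. same_block r s})"
proof -
  let ?Z = "symmetric_weight_ops :: 'k operator set" and ?B = "{x r s | r s. same_block r s}"
  define a where "a X r s = (if same_block r s then X (block_vec s) $ r else 0)"
    for X :: "'k operator" and r s
  define \<phi> where "\<phi> X = (\<Sum>r\<in>UNIV. \<Sum>s\<in>UNIV. rook_scale (a X r s) (x r s))" for X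
  have a_mult: "a (X \<circ> Y) r u = (\<Sum>t\<in>UNIV. a X r t * a Y t u)" if X: "X \<in> ?Z" and Y: "Y \<in> ?Z" for X Y r u
  proof (cases "same_block r u")
    case False
    then have "a X r t * a Y t u = 0" for t
      using same_block_trans by (auto simp: a_def)
    then have "(\<Sum>t\<in>UNIV. a X r t * a Y t u) = 0" by (intro sum.neutral ballI)
    then show ?thesis using False by (simp add: a_def)
  next
    case True
    then have "wt u \<le> wt (- u)" using same_block_refl_iff same_block_sym same_block_trans by blast
    note Yu = block_expansion[OF Y this]
    have "X (Y (block_vec u)) = (\<Sum>t | same_block t u. Y (block_vec u) $ t *s X (block_vec t))"
      by (subst Yu) (simp only: linear_op_sum linear_op_scale symmetric_weight_opsD(1)[OF X])
    then have "a (X \<circ> Y) r u = (\<Sum>t | same_block t u. X (block_vec t) $ r * Y (block_vec u) $ t)"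
      using True by (simp add: a_def mult.commute)
    also have "\<dots> = (\<Sum>t | same_block t u. a X r t * a Y t u)"
    proof (rule sum.cong)
      fix t assume "t \<in> {t. same_block t u}"
      then have "same_block t u" by simp
      moreover from this have "same_block r t" using True same_block_trans same_block_sym by blast
      ultimately show "X (block_vec t) $ r * Y (block_vec u) $ t = a X r t * a Y t u"
        by (simp add: a_def)
    qed simp
    also have "\<dots> = (\<Sum>t\<in>UNIV. a X r t * a Y t u)"
      by (rule sum.mono_neutral_left) (auto simp: a_def)
    finally show ?thesis .
  qed
  \<comment> \<open>The coefficient vanishes unless the indices have equal weight, so the multiplication
    rule holds for the scaled units without side conditions.\<close>
  have scaled_mult: "rook_scale (a X r s) (x r s) * rook_scale (a Y t u) (x t u)
      = (if s = t then rook_scale (a X r s * a Y s u) (x r u) else 0)" for X Y r s t u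
  proof (cases "wt r = wt s \<and> wt t = wt u")
    case True
    then show ?thesis using mult[of r s t u] by (simp add: rook_scale_mult)
  next
    case False
    then have "a X r s = 0 \<or> a Y t u = 0" by (auto simp: a_def same_block_def)
    then show ?thesis by auto
  qed
  have \<phi>_mult: "\<phi> (X \<circ> Y) = \<phi> X * \<phi> Y" if "X \<in> ?Z" "Y \<in> ?Z" for X Y
  proof -
    have "rook_scale (a X r s) (x r s) * \<phi> Y = (\<Sum>t\<in>UNIV. \<Sum>u\<in>UNIV.
        if s = t then rook_scale (a X r s * a Y s u) (x r u) else 0)" for r s
      by (simp only: \<phi>_def sum_distrib_left scaled_mult)
    then have "\<phi> X * \<phi> Y = (\<Sum>r\<in>UNIV. \<Sum>s\<in>UNIV. \<Sum>t\<in>UNIV. \<Sum>u\<in>UNIV.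
        if s = t then rook_scale (a X r s * a Y s u) (x r u) else 0)"
      by (subst \<phi>_def[of X]) (simp only: sum_distrib_right)
    also have "\<dots> = (\<Sum>r\<in>UNIV. \<Sum>s\<in>UNIV. \<Sum>u\<in>UNIV. rook_scale (a X r s * a Y s u) (x r u))"
    proof (rule sum.cong[OF refl], rule sum.cong[OF refl])
      fix r s
      have "(\<Sum>t\<in>UNIV. \<Sum>u\<in>UNIV. if s = t then rook_scale (a X r s * a Y s u) (x r u) else 0)
          = (\<Sum>t\<in>UNIV. if s = t then \<Sum>u\<in>UNIV. rook_scale (a X r s * a Y s u) (x r u) else 0)"
        by (rule sum.cong) simp_all
      then show "(\<Sum>t\<in>UNIV. \<Sum>u\<in>UNIV. if s = t then rook_scale (a X r s * a Y s u) (x r u) else 0)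
          = (\<Sum>u\<in>UNIV. rook_scale (a X r s * a Y s u) (x r u))"
        by simp
    qed
    also have "\<dots> = (\<Sum>r\<in>UNIV. \<Sum>u\<in>UNIV. \<Sum>s\<in>UNIV. rook_scale (a X r s * a Y s u) (x r u))"
      by (rule sum.cong[OF refl]) (rule sum.swap)
    also have "\<dots> = \<phi> (X \<circ> Y)"
      by (simp add: \<phi>_def a_mult[OF that] rook.scale_sum_left)
    finally show ?thesis ..
  qed
  have a_add: "a (X + Y) r s = a X r s + a Y r s" and a_scale: "a (op_scale c X) r s = c * a X r s" for X Y c r s
    by (simp_all add: a_def plus_fun_def op_scale_def)
  have \<phi>_add: "\<phi> (X + Y) = \<phi> X + \<phi> Y" for X Y
    by (simp add: \<phi>_def a_add rook.scale_left_distrib sum.distrib)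
  have \<phi>_scale: "\<phi> (op_scale c X) = rook_scale c (\<phi> X)" for c X
    by (simp add: \<phi>_def a_scale rook.scale_sum_right)
  have \<phi>_unit: "\<phi> (block_unit r s) = x r s" if rs: "same_block r s" for r s
  proof -
    have "a (block_unit r s) p q = (if p = r \<and> q = s then 1 else 0)" for p q
    proof (cases "same_block p q")
      case True
      then have "wt q \<le> wt (- q)" using same_block_refl_iff same_block_sym same_block_trans by blast
      then have "a (block_unit r s) p q = (if s = q then block_vec r $ p else 0)"
        using True block_unit_block_vec[OF rs] by (simp add: a_def)
      moreover have "block_vec r $ p = (if p = r then 1 else 0)" if "s = q"
        using True rs that same_block_sym same_block_trans by (intro block_vec_component) blast
      ultimately show ?thesis by auto
    next
      case False
      then show ?thesis using rs by (auto simp: a_def)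
    qed
    then have "\<phi> (block_unit r s) = (\<Sum>p\<in>UNIV. \<Sum>q\<in>UNIV. if q = s then if p = r then x r s else 0 else 0)"
      unfolding \<phi>_def by (intro sum.cong refl) auto
    then show ?thesis by simp
  qed
  have \<phi>_inj: "X = 0" if X: "X \<in> ?Z" and \<phi>X: "\<phi> X = 0" for X
  proof (rule block_vec_separating[OF X])
    fix s :: "'k tuple" assume s: "wt s \<le> wt (- s)"
    have "X (block_vec s) $ t = 0" if t: "same_block t s" for t
    proof -
      \<comment> \<open>Multiplying with diagonal units on both sides isolates one coefficient.\<close>
      have "x t t * rook_scale (a X p q) (x p q) * x s s
          = (if q = s then if p = t then rook_scale (a X t s) (x t s) else 0 else 0)" for p q
      proof (cases "wt p = wt q")
        case True
        have "wt t = wt s" using t by (simp add: same_block_def)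
        then show ?thesis using True by (auto simp: rook_scale_mult mult)
      next
        case False
        then have "a X p q = 0" "p = t \<Longrightarrow> q \<noteq> s" using t by (auto simp: a_def same_block_def)
        then show ?thesis by auto
      qed
      then have "x t t * \<phi> X * x s s
          = (\<Sum>p\<in>UNIV. \<Sum>q\<in>UNIV. if q = s then if p = t then rook_scale (a X t s) (x t s) else 0 else 0)"
        by (simp only: \<phi>_def sum_distrib_left sum_distrib_right)
      then have "rook_scale (a X t s) (x t s) = 0" using \<phi>X by simp
      moreover have "x t s \<noteq> 0" using t nz by (simp add: same_block_def)
      ultimately show ?thesis using t by (simp add: a_def)
    qed
    then show "X (block_vec s) = 0" by (subst block_expansion[OF X s]) simp
  qed
  have "inj_on \<phi> ?Z"
  proof (rule inj_onI)
    fix X Y assume X: "X \<in> ?Z" and Y: "Y \<in> ?Z" and eq: "\<phi> X = \<phi> Y"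
    have "\<phi> (X - Y) + \<phi> Y = \<phi> X" by (simp add: \<phi>_add[symmetric])
    then have "\<phi> (X - Y) = 0" using eq by simp
    then have "X - Y = 0"
      using \<phi>_inj opr.subspace_diff[OF subspace_symmetric_weight_ops X Y] by blast
    then show "X = Y" by simp
  qed
  moreover have "\<phi> ` ?Z = rook.span ?B"
  proof (rule antisym)
    have "rook_scale (a X r s) (x r s) \<in> rook.span ?B" for X r s
    proof (cases "same_block r s")
      case True
      then have "x r s \<in> rook.span ?B" by (intro rook.span_base) blast
      then show ?thesis by (rule rook.span_scale)
    qed (simp add: a_def rook.span_zero)
    then show "\<phi> ` ?Z \<subseteq> rook.span ?B"
      by (auto simp: \<phi>_def intro!: rook.span_sum)
    have "rook.subspace (\<phi> ` ?Z)"
    proof (rule rook.subspaceI)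
      have "\<phi> 0 = 0" using \<phi>_scale[of 0 0] by simp
      then show "0 \<in> \<phi> ` ?Z"
        using opr.subspace_0[OF subspace_symmetric_weight_ops] by (metis imageI)
    next
      fix p q assume "p \<in> \<phi> ` ?Z" "q \<in> \<phi> ` ?Z"
      then obtain X Y where XY: "X \<in> ?Z" "Y \<in> ?Z" "p = \<phi> X" "q = \<phi> Y" by blast
      have "X + Y \<in> ?Z" by (rule opr.subspace_add[OF subspace_symmetric_weight_ops XY(1,2)])
      then show "p + q \<in> \<phi> ` ?Z" unfolding XY(3,4) \<phi>_add[symmetric] by (rule imageI)
    next
      fix c p assume "p \<in> \<phi> ` ?Z"
      then obtain X where X: "X \<in> ?Z" "p = \<phi> X" by blast
      have "op_scale c X \<in> ?Z" by (rule opr.subspace_scale[OF subspace_symmetric_weight_ops X(1)])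
      then show "rook_scale c p \<in> \<phi> ` ?Z" unfolding X(2) \<phi>_scale[symmetric] by (rule imageI)
    qed
    moreover have "?B \<subseteq> \<phi> ` ?Z"
      using \<phi>_unit block_unit_mem by (auto intro!: rev_image_eqI)
    ultimately show "rook.span ?B \<subseteq> \<phi> ` ?Z" by (rule rook.span_minimal[rotated])
  qed
  ultimately have "bij_betw \<phi> ?Z (rook.span ?B)" by (simp add: bij_betw_def)
  then show ?thesis
    unfolding algebra_iso_def using \<phi>_add \<phi>_mult \<phi>_scale by blast
qed

lemma same_block_iff:
  fixes r s :: "'k::{finite,linorder} tuple"
  shows "same_block r s \<longleftrightarrow> wt r = wt s \<and>
    (2 * wt r < CARD('k) \<or> 2 * wt r = CARD('k) \<and> (r \<succ> - r \<longleftrightarrow> s \<succ> - s))"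
proof (cases "wt r = wt s")
  case True
  then show ?thesis
    using wt_add_uminus[of r] wt_add_uminus[of s] by (auto simp: same_block_def block_sign_def)
qed (simp add: same_block_def)

lemma wt_tuple_of_set: "wt (tuple_of_set R) = card R"
  by (simp add: wt_def tuple_of_set_def)

text \<open>
  The two cases of the definition are instances of one condition: a subset and its tuple have
  the same block structure, and for odd \<open>k\<close> the middle weight is empty.
\<close>

lemma Q_basis_eq:
  fixes X :: "'k::{finite,linorder} set \<Rightarrow> 'k set \<Rightarrow> 'k rook_algebra"
  shows "Q_basis X = {X R S | R S. same_block (tuple_of_set R) (tuple_of_set S)}"
proof -
  have block: "same_block (tuple_of_set R) (tuple_of_set S) \<longleftrightarrow> card R = card S \<and>
      (2 * card R < CARD('k) \<or> 2 * card R = CARD('k) \<and>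
        (tuple_of_set R \<succ> tuple_of_set (- R) \<longleftrightarrow> tuple_of_set S \<succ> tuple_of_set (- S)))"
    for R S :: "'k set"
    by (simp add: same_block_iff wt_tuple_of_set tuple_of_set_uminus)
  show ?thesis
  proof (cases "odd CARD('k)")
    case True
    then have "2 * n \<noteq> CARD('k)" for n by presburger
    moreover from True have "real n \<le> (real CARD('k) - 1) / 2 \<longleftrightarrow> 2 * n < CARD('k)" for n
      by (auto elim!: oddE)
    ultimately have "card R = card S \<and> real (card S) \<le> (real CARD('k) - 1) / 2
        \<longleftrightarrow> same_block (tuple_of_set R) (tuple_of_set S)" for R S :: "'k set"
      unfolding block by metis
    then show ?thesis using True by (simp only: Q_basis_def if_True not_False_eq_True)
  next
    case False
    then have low: "real n \<le> (real CARD('k) - 2) / 2 \<longleftrightarrow> 2 * n < CARD('k)" for n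
      by (auto elim!: evenE)
    have mid: "real n = real CARD('k) / 2 \<longleftrightarrow> 2 * n = CARD('k)" for n by linarith
    have compl: "2 * card (- R) = CARD('k) \<longleftrightarrow> 2 * card R = CARD('k)" for R :: "'k set"
      using wt_add_uminus[of "tuple_of_set R"]
      by (simp add: wt_tuple_of_set tuple_of_set_uminus[symmetric]) linarith
    have neg: "tuple_of_set (- R) \<succ> tuple_of_set R \<longleftrightarrow> \<not> tuple_of_set R \<succ> tuple_of_set (- R)"
      for R :: "'k set"
      by (simp add: tuple_of_set_uminus uminus_gt_iff)
    let ?M = "{(R :: 'k set, S :: 'k set). card R = card S \<and> 2 * card S = CARD('k) \<and>
      tuple_of_set R \<succ> tuple_of_set (- R) \<and> tuple_of_set S \<succ> tuple_of_set (- S)}"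
    have Q: "Q_basis X = {X R S | R S. card R = card S \<and> 2 * card S < CARD('k)} \<union>
      (\<Union>(R, S) \<in> ?M. {X R S, X (- R) (- S)})"
      using False by (simp only: Q_basis_def low mid if_False)
    show ?thesis
    proof (rule antisym)
      show "Q_basis X \<subseteq> {X R S | R S. same_block (tuple_of_set R) (tuple_of_set S)}"
      proof
        fix y assume "y \<in> Q_basis X"
        then consider R S where "y = X R S" "card R = card S" "2 * card S < CARD('k)"
          | R S where "y = X R S \<or> y = X (- R) (- S)" "card R = card S" "2 * card S = CARD('k)"
              "tuple_of_set R \<succ> tuple_of_set (- R)" "tuple_of_set S \<succ> tuple_of_set (- S)"
          unfolding Q by blast
        then show "y \<in> {X R S | R S. same_block (tuple_of_set R) (tuple_of_set S)}"
        proof cases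
          case 1
          then have "same_block (tuple_of_set R) (tuple_of_set S)" by (simp add: block)
          then show ?thesis using 1(1) by blast
        next
          case 2
          then have "same_block (tuple_of_set R) (tuple_of_set S)"
            "same_block (tuple_of_set (- R)) (tuple_of_set (- S))"
            using compl[of R] compl[of S] by (simp_all add: block neg)
          then show ?thesis using 2(1) by blast
        qed
      qed
      show "{X R S | R S. same_block (tuple_of_set R) (tuple_of_set S)} \<subseteq> Q_basis X"
      proof
        fix y assume "y \<in> {X R S | R S. same_block (tuple_of_set R) (tuple_of_set S)}"
        then obtain R S where y: "y = X R S" and RS: "same_block (tuple_of_set R) (tuple_of_set S)"
          by blast
        consider "card R = card S" "2 * card S < CARD('k)" | "(R, S) \<in> ?M" | "(- R, - S) \<in> ?M"
          using RS compl[of R] compl[of S] neg[of R] neg[of S] unfolding block by auto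
        then show "y \<in> Q_basis X"
        proof cases
          case 3
          then have "X (- (- R)) (- (- S)) \<in> (\<Union>(R, S) \<in> ?M. {X R S, X (- R) (- S)})" by blast
          then show ?thesis by (simp add: Q y)
        qed (unfold Q y, blast+)
      qed
    qed
  qed
qed

text \<open>
  Reindexing the matrix units by tuples turns \<open>Q_basis X\<close> into the units with indices in a
  common block.  As lying in a common block is transitive, these units are closed under
  products up to 0.
\<close>

lemma Q_alg_properties:
  fixes X :: "'k::{finite,linorder} set \<Rightarrow> 'k set \<Rightarrow> 'k rook_algebra"
  assumes X: "rook_matrix_units X"
  shows "rook_subalgebra (Q_alg X)" and "rook_basis (Q_basis X) (Q_alg X)"
    and "algebra_iso (symmetric_weight_ops :: 'k operator set) (Q_alg X)"
proof -
  define x where "x r s = X {j. r j = False} {j. s j = False}" for r s :: "'k tuple"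
  have X_x: "X R S = x (tuple_of_set R) (tuple_of_set S)" for R S
    by (simp add: x_def tuple_of_set_def)
  have "tuple_of_set {j. r j = False} = r" for r :: "'k tuple"
    by (auto simp: tuple_of_set_def)
  then have Q: "Q_basis X = {x r s | r s. same_block r s}"
    unfolding Q_basis_eq X_x by metis
  have mult: "x r s * x t u = (if s = t then x r u else 0)" if "wt r = wt s" "wt t = wt u" for r s t u
  proof -
    have "{j. s j = False} = {j. t j = False} \<longleftrightarrow> s = t" by (auto simp: fun_eq_iff)
    then show ?thesis
      using X that by (simp add: rook_matrix_units_def x_def wt_def)
  qed
  have ind: "rook.independent {X R S | R S. card R = card S}"
    using X by (simp add: rook_matrix_units_def rook_basis_def)
  have sub: "{x r s | r s. wt r = wt s} \<subseteq> {X R S | R S. card R = card S}"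
    by (auto simp: x_def wt_def)
  have nz: "x r s \<noteq> 0" if "wt r = wt s" for r s
    using rook.dependent_zero ind sub that by (metis (mono_tags, lifting) mem_Collect_eq subsetD)
  show "algebra_iso (symmetric_weight_ops :: 'k operator set) (Q_alg X)"
    unfolding Q_alg_def Q by (rule algebra_iso_matrix_units[OF mult nz])
  have "Q_basis X \<subseteq> {x r s | r s. wt r = wt s}"
    unfolding Q same_block_def by blast
  then have "Q_basis X \<subseteq> {X R S | R S. card R = card S}" using sub by (rule subset_trans)
  then have "rook.independent (Q_basis X)" by (rule rook.independent_mono[OF ind])
  then show "rook_basis (Q_basis X) (Q_alg X)" by (simp add: rook_basis_def Q_alg_def)
  have basis_mult: "p * q \<in> Q_alg X" if p: "p \<in> Q_basis X" and q: "q \<in> Q_basis X" for p q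
  proof -
    obtain r s t u where rs: "p = x r s" "same_block r s" and tu: "q = x t u" "same_block t u"
      using p q unfolding Q by blast
    then have "p * q = (if s = t then x r u else 0)" using mult by (simp add: same_block_def)
    moreover have "x r u \<in> Q_basis X" if "s = t"
      using rs tu that same_block_trans unfolding Q by blast
    ultimately show ?thesis by (simp add: Q_alg_def rook.span_base rook.span_zero)
  qed
  have subspace: "rook.subspace (Q_alg X)" by (simp add: Q_alg_def rook.subspace_span)
  have "p * q \<in> Q_alg X" if p: "p \<in> Q_alg X" and q: "q \<in> Q_alg X" for p q
    using p unfolding Q_alg_def
  proof (induction p rule: rook.span_induct_alt)
    case base
    show ?case by (simp add: rook.span_zero)
  next
    case (step c b p)
    have "b * q \<in> Q_alg X" using q unfolding Q_alg_def
    proof (induction q rule: rook.span_induct_alt)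
      case base
      show ?case by (simp add: rook.span_zero)
    next
      case (step d b' q)
      then show ?case
        using basis_mult[of b b'] \<open>b \<in> Q_basis X\<close>
        by (simp add: Q_alg_def distrib_left rook_scale_mult rook.span_add rook.span_scale)
    qed
    then show ?case
      using step by (simp add: Q_alg_def distrib_right rook_scale_mult rook.span_add rook.span_scale)
  qed
  then show "rook_subalgebra (Q_alg X)" using subspace by (simp add: rook_subalgebra_def)
qed

section \<open>The structure of the centralizer algebra\<close>

(* The case t = - s excluded in the rule for e_pm is treated in e_pm_w_vec_opposite. *)
theorem theorem3p43:
  fixes \<theta> :: real and \<zeta> :: complex and k :: nat
    and Z_D Z_C :: "'k::{finite,linorder} operator set"
  assumes k: "k = CARD('k)"
    and \<zeta>: "\<zeta> = exp (\<i> * of_real \<theta>)"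
    and not_root_of_unity: "\<forall>n>0. \<zeta> ^ n \<noteq> 1"
    and Z_D: "Z_D = centralizer (D_inf \<zeta>)"
    and Z_C: "Z_C = centralizer (C_inf \<zeta>)"
  shows
    "Z_D = {X \<in> Z_C. tact h_mat \<circ> X = X \<circ> tact h_mat} \<and>
     op_basis {E_unit r s + E_unit (- r) (- s) | r s. r \<succ> - r \<and> wt r = wt s} Z_D \<and>
     real (opr.dim Z_D) = 1/2 * real (opr.dim Z_C) \<and>
     1/2 * real (opr.dim Z_C) = 1/2 * real ((2 * k) choose k) \<and>
     1/2 * real ((2 * k) choose k) = real ((2 * k - 1) choose k) \<and>
     real ((2 * k - 1) choose k) = 1/2 * coeff ([:1, 1:] ^ (2 * k)) k \<and>
     (\<forall>l\<le>k. even (k - l) \<longrightarrow>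
        (K_set l :: 'k tuple set) = {r. real (wt r) = 1/2 * (real k - real l)}) \<and>
     (\<forall>l b. 1 \<le> l \<and> l \<le> k \<and> even (k - l) \<and> b = (k - l) div 2 \<longrightarrow>
        irreducible_module Z_D (vec.span (tvec ` K_set l)) \<and>
        vec.dim (vec.span (tvec ` (K_set l :: 'k tuple set))) = k choose b \<and>
        (\<forall>r\<in>K_set l. \<forall>s\<in>K_set l. \<forall>t\<in>K_set l.
           e_unit r s \<in> Z_D \<and> e_unit r s (tvec t) = (if s = t then tvec r else 0))) \<and>
     (\<forall>b. even k \<and> b = k div 2 \<longrightarrow>
        (\<forall>\<sigma>\<in>{1, - 1}.
           irreducible_module Z_D (vec.span (w_vec \<sigma> ` K_set 0)) \<and>
           real (vec.dim (vec.span (w_vec \<sigma> ` (K_set 0 :: 'k tuple set))))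
             = 1/2 * real (k choose b) \<and>
           (\<forall>r\<in>K_set 0. \<forall>s\<in>K_set 0. \<forall>t\<in>(K_set 0 :: 'k tuple set).
              (t \<noteq> - s \<longrightarrow> e_pm \<sigma> r s (w_vec \<sigma> t) = (if s = t then w_vec \<sigma> r else 0)) \<and>
              e_pm \<sigma> r s (w_vec (- \<sigma>) t) = 0))) \<and>
     (\<forall>X :: 'k set \<Rightarrow> 'k set \<Rightarrow> 'k rook_algebra. rook_matrix_units X \<longrightarrow>
        rook_subalgebra (Q_alg X) \<and> rook_basis (Q_basis X) (Q_alg X) \<and>
        algebra_iso Z_D (Q_alg X))"
proof -
  have z: "cmod \<zeta> = 1" using \<zeta> by (simp add: norm_exp_i_times)
  have D: "Z_D = symmetric_weight_ops"
    unfolding Z_D by (rule centralizer_D_inf[OF not_root_of_unity z])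
  have C: "Z_C = weight_ops"
    unfolding Z_C by (rule centralizer_C_inf[OF not_root_of_unity z])
  have k0: "0 < k" unfolding k by simp
  have "X \<in> Z_D \<longleftrightarrow> X \<in> {X \<in> Z_C. tact h_mat \<circ> X = X \<circ> tact h_mat}" for X
  proof (cases "X \<in> weight_ops")
    case True
    then have "linear_op X" by (simp add: weight_ops_def)
    from commutes_with_h_iff[OF this] True show ?thesis
      unfolding D C symmetric_weight_ops_def by (auto dest: sym)
  qed (simp add: D C symmetric_weight_ops_def)
  then have a: "Z_D = {X \<in> Z_C. tact h_mat \<circ> X = X \<circ> tact h_mat}" by blast
  have "{E_unit r s + E_unit (- r) (- s) | r s :: 'k tuple. r \<succ> - r \<and> wt r = wt s}
      = (\<lambda>(r, s). e_unit r s) ` {(r, s). r \<succ> - r \<and> wt r = wt s}"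
    by (auto simp: e_unit_def)
  then have b: "op_basis {E_unit r s + E_unit (- r) (- s) | r s :: 'k tuple. r \<succ> - r \<and> wt r = wt s} Z_D"
    using symmetric_weight_ops_basis(1,2) by (simp add: op_basis_def D)
  have "2 * opr.dim Z_D = opr.dim Z_C"
    unfolding D C dim_symmetric_weight_ops dim_weight_ops ..
  then have c1: "real (opr.dim Z_D) = 1/2 * real (opr.dim Z_C)" by simp
  have c2: "1/2 * real (opr.dim Z_C) = 1/2 * real ((2 * k) choose k)"
    by (simp add: C dim_weight_ops k)
  have c3: "1/2 * real ((2 * k) choose k) = real ((2 * k - 1) choose k)"
    by (simp add: central_binomial_half[OF k0])
  have c4: "real ((2 * k - 1) choose k) = 1/2 * coeff ([:1, 1:] ^ (2 * k)) k"
    using c3 by (simp add: coeff_linear_poly_power)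
  have d0: "(K_set l :: 'k tuple set) = {r. real (wt r) = 1/2 * (real k - real l)}" for l
  proof (rule Set.set_eqI)
    fix r :: "'k tuple"
    have "real (wt r) + real (wt (- r)) = real k"
      using wt_add_uminus[of r] unfolding k by (metis of_nat_add)
    moreover have "wt (- r) = wt r + l \<longleftrightarrow> real (wt (- r)) = real (wt r) + real l"
      by (metis of_nat_add of_nat_eq_iff)
    ultimately have "wt (- r) = wt r + l \<longleftrightarrow> real (wt r) = 1/2 * (real k - real l)"
      by auto
    then show "r \<in> K_set l \<longleftrightarrow> r \<in> {r. real (wt r) = 1/2 * (real k - real l)}"
      by (simp only: K_set_iff mem_Collect_eq)
  qed
  have d1: "irreducible_module Z_D (vec.span (tvec ` K_set l)) \<and>
      vec.dim (vec.span (tvec ` (K_set l :: 'k tuple set))) = k choose b \<and>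
      (\<forall>r\<in>K_set l. \<forall>s\<in>K_set l. \<forall>t\<in>K_set l.
        e_unit r s \<in> Z_D \<and> e_unit r s (tvec t) = (if s = t then tvec r else 0))"
    if l: "1 \<le> l \<and> l \<le> k \<and> even (k - l) \<and> b = (k - l) div 2" for l b
  proof -
    have l': "1 \<le> l" "l \<le> CARD('k)" "even (CARD('k) - l)" using l unfolding k by blast+
    have "e_unit r s \<in> Z_D \<and> e_unit r s (tvec t) = (if s = t then tvec r else 0)"
      if rst: "r \<in> K_set l" "s \<in> K_set l" "t \<in> K_set l" for r s t
    proof -
      have "wt r = wt s" using rst by (simp add: K_set_eq_wt[OF l'(2,3)])
      moreover have "t \<noteq> - s" using rst l'(1) by (auto simp: K_set_iff)
      ultimately show ?thesis unfolding D by (blast intro: e_unit_mem e_unit_tvec)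
    qed
    then show ?thesis
      using irreducible_K_set[OF l'] l by (simp add: D k)
  qed
  have d2: "irreducible_module Z_D (vec.span (w_vec \<sigma> ` K_set 0)) \<and>
      real (vec.dim (vec.span (w_vec \<sigma> ` (K_set 0 :: 'k tuple set)))) = 1/2 * real (k choose b) \<and>
      (\<forall>r\<in>K_set 0. \<forall>s\<in>K_set 0. \<forall>t\<in>(K_set 0 :: 'k tuple set).
        (t \<noteq> - s \<longrightarrow> e_pm \<sigma> r s (w_vec \<sigma> t) = (if s = t then w_vec \<sigma> r else 0)) \<and>
        e_pm \<sigma> r s (w_vec (- \<sigma>) t) = 0)"
    if b: "even k \<and> b = k div 2" and \<sigma>: "\<sigma> \<in> {1, - 1}" for b \<sigma>
  proof -
    have e: "even CARD('k)" using b by (simp add: k)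
    have "2 * vec.dim (vec.span (w_vec \<sigma> ` (K_set 0 :: 'k tuple set))) = k choose b"
      using irreducible_K_set_0(2)[OF e \<sigma>] b by (simp add: k)
    then have "real (vec.dim (vec.span (w_vec \<sigma> ` (K_set 0 :: 'k tuple set)))) = 1/2 * real (k choose b)"
      by linarith
    then show ?thesis
      using irreducible_K_set_0(1)[OF e \<sigma>] e_pm_w_vec[OF e \<sigma>] unfolding D by blast
  qed
  have e: "rook_subalgebra (Q_alg X) \<and> rook_basis (Q_basis X) (Q_alg X) \<and> algebra_iso Z_D (Q_alg X)"
    if "rook_matrix_units X" for X :: "'k set \<Rightarrow> 'k set \<Rightarrow> 'k rook_algebra"
    using Q_alg_properties[OF that] by (simp add: D)
  show ?thesis
    by (intro conjI; (fact a b c1 c2 c3 c4 | (intro allI impI, rule d0) | (intro allI impI, erule d1)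
      | (intro allI impI ballI, erule d2, assumption) | (intro allI impI, erule e)))
qed

end
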